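(* (i) For every fixed integer $k\ge 3$ there exist constants $c_1,c_2>0$ (depending only on $k$) such that, asymptotically almost surely as $n\to\infty$, $$ n-c_2\,(\log_2 n)^{1/(2k-2)}\;\le\;\chi\big(KG_{n,k}(1/2)\big)\;\le\; n-c_1\,(\log_2 n)^{1/(2k-2)} .$$ (ii) For $k=2$ there exist absolute constants $c_1,c_2>0$ such that, asymptotically almost surely as $n\to\infty$, $$ n-c_2\,\sqrt{\log_2 n\cdot\log_2\log_2 n}\;\le\;\chi\big(KG_{n,2}(1/2)\big)\;\le\; n-c_1\,\sqrt{\log_2 n\cdot \log_2\log_2 n} .$$
   Context: For positive integers $n\ge 2k$, the Kneser graph $KG_{n,k}$ has as vertices all $k$-element subsets of $[n]=\{1,\dots,n\}$, with two vertices adjacent iff the sets are disjoint. The random Kneser graph $KG_{n,k}(p)$ is the random graph on the same vertex set obtained by including each edge of $KG_{n,k}$ independently with probability $p$. $\chi$ denotes the chromatic number. "Asymptotically almost surely" (a.a.s.) means with probability tending to $1$ as $n\to\infty$. *)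

theory Defs
  imports "HOL-Probability.Probability" "HOL-Library.Ramsey"
begin

type_synonym 'a ugraph = "'a set \<times> 'a set set"

definition verts :: "'a ugraph \<Rightarrow> 'a set" where
  "verts G = fst G"

definition edges :: "'a ugraph \<Rightarrow> 'a set set" where
  "edges G = snd G"

definition proper_coloring :: "'a ugraph \<Rightarrow> nat \<Rightarrow> ('a \<Rightarrow> nat) \<Rightarrow> bool" where
  "proper_coloring G m c \<longleftrightarrow>
     c \<in> verts G \<rightarrow> {..<m} \<and> (\<forall>u v. {u, v} \<in> edges G \<longrightarrow> c u \<noteq> c v)"

text \<open>Only meaningful for finite graphs without loops, where a proper colouring exists
  (see \<open>proper_coloring_chromatic_number\<close> below).\<close>

definition chromatic_number :: "'a ugraph \<Rightarrow> nat" where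
  "chromatic_number G = (LEAST m. \<exists>c. proper_coloring G m c)"

text \<open>For \<open>k > 0\<close> disjoint \<open>k\<close>-sets are distinct, so every edge is a genuine two-element set;
  \<open>k = 0\<close> is not intended (it gives a loop).\<close>

definition kneser_graph :: "nat \<Rightarrow> nat \<Rightarrow> nat set ugraph" where
  "kneser_graph n k =
     (nsets {1..n} k,
      {{A, B} | A B. A \<in> nsets {1..n} k \<and> B \<in> nsets {1..n} k \<and> A \<inter> B = {}})"

definition random_subgraph :: "'a ugraph \<Rightarrow> real \<Rightarrow> 'a ugraph pmf" where
  "random_subgraph G p =
     map_pmf (\<lambda>present. (verts G, {e \<in> edges G. present e}))
       (Pi_pmf (edges G) False (\<lambda>_. bernoulli_pmf p))"

definition random_kneser_graph :: "nat \<Rightarrow> nat \<Rightarrow> real \<Rightarrow> nat set ugraph pmf" where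
  "random_kneser_graph n k p = random_subgraph (kneser_graph n k) p"

definition asymp_almost_surely :: "(nat \<Rightarrow> 'a pmf) \<Rightarrow> (nat \<Rightarrow> 'a \<Rightarrow> bool) \<Rightarrow> bool" where
  "asymp_almost_surely M P \<longleftrightarrow>
     (\<lambda>n. measure_pmf.prob (M n) {x. P n x}) \<longlonglongrightarrow> 1"

lemma proper_coloring_chromatic_number:
  assumes "finite (verts G)"
    and "\<And>e. e \<in> edges G \<Longrightarrow> e \<subseteq> verts G \<and> card e = 2"
  shows "\<exists>c. proper_coloring G (chromatic_number G) c"
proof -
  obtain f :: "'a \<Rightarrow> nat" and m where f: "f ` verts G = {i. i < m}" "inj_on f (verts G)"
    using finite_imp_inj_to_nat_seg[OF assms(1)] by blast
  have "f u \<noteq> f v" if "{u, v} \<in> edges G" for u v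
  proof -
    have "u \<in> verts G" "v \<in> verts G" "u \<noteq> v"
      using assms(2)[OF that] by auto
    then show ?thesis
      using f(2) by (auto dest: inj_onD)
  qed
  then have "proper_coloring G m f"
    using f(1) by (auto simp: proper_coloring_def)
  then have "\<exists>m c. proper_coloring G m c"
    by blast
  then show ?thesis
    unfolding chromatic_number_def by (rule LeastI_ex)
qed

lemma finite_verts_kneser_graph: "finite (verts (kneser_graph n k))"
  by (simp add: verts_def kneser_graph_def finite_imp_finite_nsets)

lemma edges_kneser_graph:
  assumes "k > 0" "e \<in> edges (kneser_graph n k)"
  shows "e \<subseteq> verts (kneser_graph n k) \<and> card e = 2"
proof -
  obtain A B where AB: "e = {A, B}" "A \<in> nsets {1..n} k" "B \<in> nsets {1..n} k" "A \<inter> B = {}"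
    using assms(2) by (auto simp: edges_def kneser_graph_def)
  then have "A \<noteq> B"
    using assms(1) by (auto simp: nsets_def)
  then show ?thesis
    using AB by (auto simp: verts_def kneser_graph_def)
qed

lemma finite_edges_kneser_graph: "finite (edges (kneser_graph n k))"
proof (rule finite_subset)
  show "edges (kneser_graph n k) \<subseteq> Pow (verts (kneser_graph n k))"
    by (auto simp: edges_def verts_def kneser_graph_def)
qed (simp add: finite_verts_kneser_graph)

end

theory Submission
  imports Defs "HOL-Real_Asymp.Real_Asymp"
begin

text \<open>
  Write \<open>L = log 2 n\<close>. Colouring every \<open>k\<close>-set by its largest element uses \<open>n\<close> colours, each class being
  a star; the question is how many colours can be saved when half of the conflicts disappear.

  Upper bound. Fix a core \<open>Y\<close> of \<open>d\<close> elements which get no star of their own, so that \<open>d\<close> colours are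
  saved and the \<open>k\<close>-subsets of \<open>Y\<close> have to be hidden in the classes of other elements. Starting from
  \<open>T = Y\<close>, elements \<open>z\<close> are added to \<open>T\<close> one at a time; the class of \<open>z\<close> consists of the \<open>k\<close>-sets of
  \<open>T \<union> {z}\<close> through \<open>z\<close> and of a few sets of the core with a common element. If \<open>s\<close> core sets are hidden
  when \<open>card T = i\<close>, at most \<open>s * i ^ (k - 1)\<close> edges have to be missing; as long as this number is at most
  \<open>L / 2\<close>, a given \<open>z\<close> works with probability at least \<open>1 / sqrt n\<close>, and almost surely every situation
  \<open>(T, E)\<close> with few elements admits some \<open>z\<close> (\<open>asymp_almost_surely_absorbing\<close>). The core is exhausted
  once the sum of \<open>L / i ^ (k - 1)\<close> over \<open>i \<ge> d\<close> exceeds about \<open>d ^ k\<close>. For \<open>k \<ge> 3\<close> this sum is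
  dominated by \<open>i\<close> of order \<open>d\<close> and gives \<open>d ^ (2 * k - 2)\<close> of order \<open>L\<close>; for \<open>k = 2\<close> it is harmonic, and
  this is where the additional factor \<open>log 2 L\<close> comes from.

  Lower bound. The same sum governs the converse. Given a proper colouring with fewer than \<open>n - t\<close>
  colours, repeatedly remove from the ground set an element \<open>x\<close> together with a colour \<open>j\<close> such that
  only few sets of colour \<open>j\<close> miss \<open>x\<close>; these few sets become uncoloured. If \<open>m\<close> elements are left, a
  constant multiple of \<open>L / m ^ (k - 1) + log 2 m\<close> sets may be given up as long as \<open>m ^ (k - 1)\<close> is below a multiple of \<open>L\<close>, and
  none beyond. The total loss is then a small fraction of \<open>t ^ k\<close>, and since there are always at least
  \<open>t\<close> more elements than colours, the process stops at some set \<open>S\<close> of \<open>m \<ge> t\<close> elements almost all of whose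
  \<open>k\<close>-sets are coloured with at most \<open>m\<close> colours, no class being close to a star. Two almost sure
  properties of the random graph exclude this.

  First, independent classes contain few disjoint pairs: a union bound over all partial
  colourings bounds the number of monochromatic disjoint pairs by a multiple of
  \<open>m * L + card D * log 2 m\<close>, where \<open>D\<close> is the family of coloured sets (\<open>conflict_free_sparse\<close>). In a large
  class every set missing the most popular element is disjoint from a positive fraction of the class, so the
  classes far from stars contain only a small fraction of all \<open>k\<close>-sets
  (\<open>card_spread_classes_le\<close>). This settles small \<open>m\<close>.

  Second, for large \<open>m\<close> every class may be a star up to a single witness \<open>b j\<close> missing its centre
  \<open>x j\<close>. A \<open>k\<close>-set which is joined to the witnesses of all classes centred at its elements belongs to none
  of these stars. On average a \<open>k\<close>-set has boundedly many such classes, so with positive probability it is blocked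
  in this way, and by a Chernoff-type bound a positive proportion of the \<open>k\<close>-sets is blocked, for all
  choices of centres and witnesses simultaneously (\<open>blocking\<close>). The blocked sets would have to be
  uncoloured, in classes far from stars, or outside the star of their class, and there are too few such sets.
\<close>

section \<open>Blocks of edges in a random subgraph\<close>

text \<open>The basic event of all estimates below: a prescribed set of edges is entirely present
  (\<open>v = True\<close>) or entirely absent (\<open>v = False\<close>).\<close>
lemma prob_random_subgraph_half_agree:
  assumes fin: "finite (edges G)" and Q: "Q \<subseteq> edges G"
  shows "measure_pmf.prob (random_subgraph G (1/2)) {X. \<forall>e\<in>Q. e \<in> edges X \<longleftrightarrow> v} = (1/2) ^ card Q"
proof -
  let ?W = "Pi_pmf (edges G) False (\<lambda>_. bernoulli_pmf (1/2))"
  let ?B = "\<lambda>e. if e \<in> Q then {v} else UNIV"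
  have "measure_pmf.prob (random_subgraph G (1/2)) {X. \<forall>e\<in>Q. e \<in> edges X \<longleftrightarrow> v}
      = measure_pmf.prob ?W {f. \<forall>e\<in>Q. f e = v}"
    unfolding random_subgraph_def using Q by (auto simp: edges_def vimage_def intro!: arg_cong[where f="measure_pmf.prob _"])
  also have "\<dots> = measure_pmf.prob ?W (Pi (edges G) ?B)"
    using Q by (intro arg_cong[where f="measure_pmf.prob _"]) (auto simp: Pi_def)
  also have "\<dots> = (\<Prod>e\<in>edges G. measure_pmf.prob (bernoulli_pmf (1/2)) (?B e))"
    by (rule measure_Pi_pmf_Pi[OF fin])
  also have "\<dots> = (\<Prod>e\<in>edges G. if e \<in> Q then 1/2 else 1)"
    by (intro prod.cong refl) (cases v; simp add: measure_pmf_single)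
  also have "\<dots> = (\<Prod>e\<in>Q. 1/2)"
    using Q fin by (simp add: prod.inter_restrict[symmetric] Int_absorb1)
  finally show ?thesis by simp
qed

text \<open>Independence over disjoint blocks of edges, by expanding the product on both sides: each term
  of the expansion is the probability that a union of blocks is entirely present or absent.\<close>
lemma expectation_prod_blocks:
  fixes \<alpha> :: real
  assumes fin: "finite (edges G)" "finite I" and Q: "\<And>s. s \<in> I \<Longrightarrow> Q s \<subseteq> edges G"
    and disj: "disjoint_family_on Q I"
  shows "measure_pmf.expectation (random_subgraph G (1/2))
           (\<lambda>X. \<Prod>s\<in>I. 1 - \<alpha> * indicator {X. \<forall>e\<in>Q s. e \<in> edges X \<longleftrightarrow> v} X)
         = (\<Prod>s\<in>I. 1 - \<alpha> * (1/2) ^ card (Q s))"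
proof -
  let ?M = "random_subgraph G (1/2)"
  let ?A = "\<lambda>s. {X. \<forall>e\<in>Q s. e \<in> edges X \<longleftrightarrow> v}"
  have prod_ind: "(\<Prod>s\<in>J. - \<alpha> * indicator (?A s) X)
      = (-\<alpha>) ^ card J * indicator {X. \<forall>e\<in>\<Union>(Q`J). e \<in> edges X \<longleftrightarrow> v} X" if "finite J" for J X
    using that by (induction J) (auto simp: indicator_def)
  have "measure_pmf.expectation ?M (\<lambda>X. \<Prod>s\<in>I. 1 - \<alpha> * indicator (?A s) X)
      = measure_pmf.expectation ?M (\<lambda>X. \<Sum>J\<in>Pow I. (-\<alpha>) ^ card J * indicator {X. \<forall>e\<in>\<Union>(Q`J). e \<in> edges X \<longleftrightarrow> v} X)"
  proof (intro arg_cong[where f="measure_pmf.expectation _"] ext)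
    fix X
    have "(\<Prod>s\<in>I. 1 - \<alpha> * indicator (?A s) X) = (\<Prod>s\<in>I. (- \<alpha> * indicator (?A s) X) + 1)"
      by simp
    also have "\<dots> = (\<Sum>J\<in>Pow I. (\<Prod>s\<in>J. - \<alpha> * indicator (?A s) X) * (\<Prod>s\<in>I-J. 1))"
      by (rule prod_add[OF fin(2)])
    also have "\<dots> = (\<Sum>J\<in>Pow I. (-\<alpha>) ^ card J * indicator {X. \<forall>e\<in>\<Union>(Q`J). e \<in> edges X \<longleftrightarrow> v} X)"
      using fin(2) by (intro sum.cong refl) (subst prod_ind, auto dest: finite_subset)
    finally show "(\<Prod>s\<in>I. 1 - \<alpha> * indicator (?A s) X) = \<dots>" .
  qed
  also have "\<dots> = (\<Sum>J\<in>Pow I. (-\<alpha>) ^ card J * measure_pmf.prob ?M {X. \<forall>e\<in>\<Union>(Q`J). e \<in> edges X \<longleftrightarrow> v})"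
    by (subst Bochner_Integration.integral_sum) (auto intro!: integrable_mult_right integrable_real_indicator simp: measure_pmf.emeasure_eq_measure)
  also have "\<dots> = (\<Sum>J\<in>Pow I. (\<Prod>s\<in>J. - \<alpha> * (1/2) ^ card (Q s)) * (\<Prod>s\<in>I-J. 1))"
  proof (intro sum.cong refl)
    fix J assume J: "J \<in> Pow I"
    hence finJ: "finite J" using fin(2) finite_subset by auto
    have "measure_pmf.prob ?M {X. \<forall>e\<in>\<Union>(Q`J). e \<in> edges X \<longleftrightarrow> v} = (1/2) ^ card (\<Union>(Q`J))"
      using Q J by (intro prob_random_subgraph_half_agree[OF fin(1)]) auto
    also have "card (\<Union>(Q`J)) = (\<Sum>s\<in>J. card (Q s))"
    proof (rule card_UN_disjoint[OF finJ])
      show "\<forall>s\<in>J. finite (Q s)" using J Q fin(1) by (meson PowD finite_subset subsetD)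
      show "\<forall>s\<in>J. \<forall>s'\<in>J. s \<noteq> s' \<longrightarrow> Q s \<inter> Q s' = {}"
        using J disj by (auto simp only: disjoint_family_on_def Pow_iff subset_iff)
    qed
    finally show "(-\<alpha>) ^ card J * measure_pmf.prob ?M {X. \<forall>e\<in>\<Union>(Q`J). e \<in> edges X \<longleftrightarrow> v}
        = (\<Prod>s\<in>J. - \<alpha> * (1/2) ^ card (Q s)) * (\<Prod>s\<in>I-J. 1)"
      by (simp only: power_sum prod.distrib prod_constant) simp
  qed
  also have "\<dots> = (\<Prod>s\<in>I. (- \<alpha> * (1/2) ^ card (Q s)) + 1)"
    by (rule prod_add[OF fin(2), symmetric])
  finally show ?thesis by simp
qed

lemma prob_no_block_absent:
  assumes fin: "finite (edges G)" "finite I" and Q: "\<And>s. s \<in> I \<Longrightarrow> Q s \<subseteq> edges G"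
    and disj: "disjoint_family_on Q I"
  shows "measure_pmf.prob (random_subgraph G (1/2)) {X. \<forall>s\<in>I. Q s \<inter> edges X \<noteq> {}}
         = (\<Prod>s\<in>I. 1 - (1/2) ^ card (Q s))"
proof -
  have "(\<Prod>s\<in>I. 1 - 1 * indicator {X. \<forall>e\<in>Q s. e \<in> edges X \<longleftrightarrow> False} X)
      = (indicator {X. \<forall>s\<in>I. Q s \<inter> edges X \<noteq> {}} X :: real)" for X :: "'a ugraph"
  proof (cases "\<forall>s\<in>I. Q s \<inter> edges X \<noteq> {}")
    case True thus ?thesis by (auto simp: indicator_def intro!: prod.neutral)
  next
    case False
    then obtain s where "s \<in> I" "Q s \<inter> edges X = {}" by blast
    thus ?thesis using False fin(2) by (auto simp: indicator_def intro!: prod_zero bexI[of _ s])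
  qed
  thus ?thesis using expectation_prod_blocks[OF assms, of 1 False] by simp
qed

text \<open>Markov's inequality for \<open>(1/2) ^ N\<close>, where \<open>N\<close> is the number of blocks that are present.\<close>
lemma prob_few_blocks_present:
  assumes fin: "finite (edges G)" "finite I" and Q: "\<And>s. s \<in> I \<Longrightarrow> Q s \<subseteq> edges G"
    and disj: "disjoint_family_on Q I"
  shows "measure_pmf.prob (random_subgraph G (1/2)) {X. real (card {s\<in>I. Q s \<subseteq> edges X}) \<le> a}
         \<le> 2 powr a * (\<Prod>s\<in>I. 1 - (1/2) * (1/2) ^ card (Q s))"
proof -
  let ?M = "random_subgraph G (1/2)"
  let ?N = "\<lambda>X. card {s\<in>I. Q s \<subseteq> edges X}"
  let ?f = "\<lambda>X. \<Prod>s\<in>I. 1 - (1/2) * indicator {X. \<forall>e\<in>Q s. e \<in> edges X \<longleftrightarrow> True} X :: real"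
  have f: "?f X = (1/2) ^ ?N X" for X :: "'a ugraph"
  proof -
    have "?f X = (\<Prod>s\<in>I. if s \<in> {s\<in>I. Q s \<subseteq> edges X} then 1/2 else 1)"
      by (intro prod.cong refl) (auto simp: indicator_def)
    also have "\<dots> = (\<Prod>s\<in>{s\<in>I. Q s \<subseteq> edges X}. 1/2)"
      using fin(2) by (simp add: prod.inter_filter[symmetric] cong: conj_cong)
    finally show ?thesis by simp
  qed
  have le: "indicator {X. real (?N X) \<le> a} X \<le> 2 powr a * ?f X" for X :: "'a ugraph"
  proof -
    have "2 powr a * ?f X = 2 powr (a - real (?N X))"
      unfolding f by (simp add: powr_diff powr_realpow power_one_over divide_simps)
    moreover have "1 \<le> 2 powr (a - real (?N X))" if "real (?N X) \<le> a"
      using that by (intro ge_one_powr_ge_zero) auto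
    ultimately show ?thesis by (simp add: indicator_def del: power_one_over)
  qed
  have "measure_pmf.prob ?M {X. real (?N X) \<le> a} = measure_pmf.expectation ?M (indicator {X. real (?N X) \<le> a})"
    by simp
  also have "\<dots> \<le> measure_pmf.expectation ?M (\<lambda>X. 2 powr a * ?f X)"
  proof (intro integral_mono_AE AE_I2 le)
    show "integrable ?M (\<lambda>X. 2 powr a * ?f X)"
      unfolding f by (intro measure_pmf.integrable_const_bound[where B="2 powr a"])
        (auto simp: power_le_one)
  qed (auto intro!: integrable_real_indicator simp: measure_pmf.emeasure_eq_measure)
  also have "\<dots> = 2 powr a * (\<Prod>s\<in>I. 1 - (1/2) * (1/2) ^ card (Q s))"
    by (simp add: expectation_prod_blocks[OF assms, of "1/2" True, simplified])
  finally show ?thesis .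
qed

section \<open>Almost sure events and counting of subsets\<close>

lemma asymp_almost_surelyI:
  assumes "\<forall>\<^sub>F n in sequentially. measure_pmf.prob (M n) {x. \<not> P n x} \<le> \<epsilon> n" "\<epsilon> \<longlonglongrightarrow> 0"
  shows "asymp_almost_surely M P"
  unfolding asymp_almost_surely_def
proof (rule tendsto_sandwich[of "\<lambda>n. 1 - \<epsilon> n" _ _ "\<lambda>_. 1"])
  show "\<forall>\<^sub>F n in sequentially. 1 - \<epsilon> n \<le> measure_pmf.prob (M n) {x. P n x}"
    using assms(1)
  proof eventually_elim
    case (elim n)
    have "{x. \<not> P n x} = UNIV - {x. P n x}" by auto
    thus ?case using elim measure_pmf.prob_compl[of "{x. P n x}" "M n"] by simp
  qed
  show "(\<lambda>n. 1 - \<epsilon> n) \<longlonglongrightarrow> 1"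
    using tendsto_diff[OF tendsto_const assms(2), of 1] by simp
qed auto

lemma asymp_almost_surely_mono:
  assumes "asymp_almost_surely M P"
    and "\<forall>\<^sub>F n in sequentially. \<forall>x\<in>set_pmf (M n). P n x \<longrightarrow> Q n x"
  shows "asymp_almost_surely M Q"
  unfolding asymp_almost_surely_def
proof (rule tendsto_sandwich[of "\<lambda>n. measure_pmf.prob (M n) {x. P n x}" _ _ "\<lambda>_. 1"])
  show "\<forall>\<^sub>F n in sequentially. measure_pmf.prob (M n) {x. P n x} \<le> measure_pmf.prob (M n) {x. Q n x}"
    using assms(2)
  proof eventually_elim
    case (elim n)
    show ?case
      by (rule measure_pmf.finite_measure_mono_AE) (use elim in \<open>auto intro!: AE_pmfI\<close>)
  qed
qed (use assms(1) in \<open>auto simp: asymp_almost_surely_def\<close>)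

lemma asymp_almost_surely_conj:
  assumes "asymp_almost_surely M P" "asymp_almost_surely M Q"
  shows "asymp_almost_surely M (\<lambda>n x. P n x \<and> Q n x)"
proof (rule asymp_almost_surelyI)
  let ?p = "\<lambda>P n. measure_pmf.prob (M n) {x. P n x}"
  show "\<forall>\<^sub>F n in sequentially. measure_pmf.prob (M n) {x. \<not> (P n x \<and> Q n x)} \<le> (1 - ?p P n) + (1 - ?p Q n)"
  proof (intro always_eventually allI)
    fix n
    have "measure_pmf.prob (M n) {x. \<not> (P n x \<and> Q n x)}
        = measure_pmf.prob (M n) ((UNIV - {x. P n x}) \<union> (UNIV - {x. Q n x}))"
      by (intro arg_cong[where f="measure_pmf.prob _"]) auto
    also have "\<dots> \<le> measure_pmf.prob (M n) (UNIV - {x. P n x}) + measure_pmf.prob (M n) (UNIV - {x. Q n x})"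
      by (rule measure_Un_le) auto
    finally show "measure_pmf.prob (M n) {x. \<not> (P n x \<and> Q n x)} \<le> (1 - ?p P n) + (1 - ?p Q n)"
      using measure_pmf.prob_compl[of _ "M n"] by simp
  qed
  show "(\<lambda>n. (1 - ?p P n) + (1 - ?p Q n)) \<longlonglongrightarrow> 0"
    using assms unfolding asymp_almost_surely_def by (auto intro!: tendsto_eq_intros)
qed

lemma prob_union_bound:
  assumes "finite I" "\<And>i. i \<in> I \<Longrightarrow> measure_pmf.prob M {x. P i x} \<le> \<beta>"
  shows "measure_pmf.prob M {x. \<exists>i\<in>I. P i x} \<le> real (card I) * \<beta>"
proof -
  have "measure_pmf.prob M {x. \<exists>i\<in>I. P i x} = measure_pmf.prob M (\<Union>i\<in>I. {x. P i x})"
    by (intro arg_cong[where f="measure_pmf.prob _"]) auto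
  also have "\<dots> \<le> (\<Sum>i\<in>I. measure_pmf.prob M {x. P i x})"
    by (rule measure_pmf.finite_measure_subadditive_finite[OF assms(1)]) auto
  also have "\<dots> \<le> (\<Sum>i\<in>I. \<beta>)" by (intro sum_mono assms)
  finally show ?thesis by simp
qed

lemma in_edges_kneser_iff:
  "{A, B} \<in> edges (kneser_graph n k) \<longleftrightarrow> A \<in> nsets {1..n} k \<and> B \<in> nsets {1..n} k \<and> A \<inter> B = {}"
  by (auto simp: edges_def kneser_graph_def doubleton_eq_iff)

lemma set_pmf_random_kneser_graph:
  assumes "X \<in> set_pmf (random_kneser_graph n k p)"
  shows "verts X = nsets {1..n} k" "edges X \<subseteq> edges (kneser_graph n k)"
  using assms by (auto simp: random_kneser_graph_def random_subgraph_def verts_def edges_def kneser_graph_def)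

lemma choose_le_power: "n choose r \<le> n ^ r"
  by (cases "r \<le> n") (auto simp: binomial_le_pow binomial_eq_0)

lemma card_nsets_superset_le:
  assumes "finite S" "A \<subseteq> S" "card A \<le> k"
  shows "card {s \<in> nsets S k. A \<subseteq> s} \<le> card S ^ (k - card A)"
proof -
  have finA: "finite A" using assms finite_subset by auto
  have "card {s \<in> nsets S k. A \<subseteq> s} \<le> card (nsets (S - A) (k - card A))"
  proof (rule card_inj_on_le[of "\<lambda>s. s - A"])
    show "inj_on (\<lambda>s. s - A) {s \<in> nsets S k. A \<subseteq> s}" by (auto simp: inj_on_def)
    show "(\<lambda>s. s - A) ` {s \<in> nsets S k. A \<subseteq> s} \<subseteq> nsets (S - A) (k - card A)"
      using finA by (auto simp: nsets_def card_Diff_subset)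
    show "finite (nsets (S - A) (k - card A))" using assms by (intro finite_imp_finite_nsets) auto
  qed
  also have "\<dots> \<le> card (S - A) ^ (k - card A)" by (simp only: card_nsets choose_le_power)
  also have "\<dots> \<le> card S ^ (k - card A)" using assms by (intro power_mono card_mono) auto
  finally show ?thesis .
qed

lemma card_nsets_le: "card (nsets S k) \<le> card S ^ k"
  by (simp only: card_nsets choose_le_power)

section \<open>Upper bound: hiding the sets of a core\<close>

definition colorable_on :: "'a ugraph \<Rightarrow> 'a set \<Rightarrow> nat \<Rightarrow> bool" where
  "colorable_on X A m \<longleftrightarrow>
     (\<exists>c. c \<in> A \<rightarrow> {..<m} \<and> (\<forall>u\<in>A. \<forall>v\<in>A. {u, v} \<in> edges X \<longrightarrow> c u \<noteq> c v))"

lemma colorable_on_Suc: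
  assumes "colorable_on X A m" "\<And>u v. u \<in> B \<Longrightarrow> v \<in> B \<Longrightarrow> {u, v} \<notin> edges X" "A' \<subseteq> A \<union> B"
  shows "colorable_on X A' (Suc m)"
proof -
  obtain c where c: "c \<in> A \<rightarrow> {..<m}" "\<And>u v. u \<in> A \<Longrightarrow> v \<in> A \<Longrightarrow> {u, v} \<in> edges X \<Longrightarrow> c u \<noteq> c v"
    using assms(1) unfolding colorable_on_def by blast
  define c' where "c' = (\<lambda>u. if u \<in> B then m else c u)"
  have "c' u \<noteq> c' v" if "u \<in> A'" "v \<in> A'" "{u, v} \<in> edges X" for u v
  proof -
    have "u \<in> A \<Longrightarrow> c u \<noteq> m" "v \<in> A \<Longrightarrow> c v \<noteq> m" using c(1) by force+
    thus ?thesis using that c(2)[of u v] assms(2)[of u v] assms(3) by (auto simp: c'_def)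
  qed
  moreover have "c' \<in> A' \<rightarrow> {..<Suc m}" using c(1) assms(3) by (force simp: c'_def)
  ultimately show ?thesis unfolding colorable_on_def by blast
qed

lemma chromatic_number_le_if_colorable_on:
  assumes "colorable_on X (verts X) m" "\<And>u v. {u, v} \<in> edges X \<Longrightarrow> u \<in> verts X \<and> v \<in> verts X"
  shows "chromatic_number X \<le> m"
  unfolding chromatic_number_def
  using assms by (intro Least_le) (unfold colorable_on_def proper_coloring_def, blast)

text \<open>The edges that must be missing for \<open>E\<close> to be hidden in the star of the new element \<open>z\<close>.\<close>
definition star_pairs :: "nat \<Rightarrow> 'a set set \<Rightarrow> 'a set \<Rightarrow> 'a \<Rightarrow> 'a set set set" where
  "star_pairs k E T z = {{e, s} | e s. e \<in> E \<and> s \<in> nsets (insert z T) k \<and> z \<in> s \<and> e \<inter> s = {}}"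

text \<open>The bound \<open>log 2 n / 2\<close> on the number of conflicts leaves each candidate \<open>z\<close> a success probability
  of at least \<open>1 / sqrt n\<close>, while there are about \<open>n\<close> candidates.\<close>
definition absorbing :: "nat \<Rightarrow> nat \<Rightarrow> nat \<Rightarrow> nat set ugraph \<Rightarrow> bool" where
  "absorbing n k D X \<longleftrightarrow>
     (\<forall>T E. T \<subseteq> {1..n} \<and> card T < D \<and> E \<subseteq> nsets T k \<and> real (card E * card T ^ (k - 1)) \<le> log 2 n / 2
        \<longrightarrow> (\<exists>z\<in>{1..n} - T. star_pairs k E T z \<inter> edges X = {}))"

lemma star_pairs_subset_kneser:
  assumes "T \<subseteq> {1..n}" "E \<subseteq> nsets T k" "z \<in> {1..n}"
  shows "star_pairs k E T z \<subseteq> edges (kneser_graph n k)"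
proof -
  have "nsets T k \<subseteq> nsets {1..n} k" "nsets (insert z T) k \<subseteq> nsets {1..n} k"
    using assms by (auto intro!: nsets_mono)
  thus ?thesis using assms(2) unfolding star_pairs_def
    by (auto simp only: in_edges_kneser_iff mem_Collect_eq) blast+
qed

lemma card_star_pairs_le:
  assumes "finite T" "z \<notin> T" "E \<subseteq> nsets T k" "k \<ge> 1"
  shows "card (star_pairs k E T z) \<le> card E * card T ^ (k - 1)"
proof -
  let ?S = "{s \<in> nsets (insert z T) k. z \<in> s}"
  have finE: "finite E" using assms finite_subset finite_imp_finite_nsets by blast
  have finS: "finite ?S" using assms by (simp add: finite_imp_finite_nsets)
  have "card ?S \<le> card (nsets T (k - 1))"
  proof (rule card_inj_on_le[of "\<lambda>s. s - {z}"])
    show "inj_on (\<lambda>s. s - {z}) ?S" by (auto simp: inj_on_def)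
    show "(\<lambda>s. s - {z}) ` ?S \<subseteq> nsets T (k - 1)" by (auto simp: nsets_def)
  qed (use assms in \<open>auto intro: finite_imp_finite_nsets\<close>)
  also have "\<dots> \<le> card T ^ (k - 1)" by (rule card_nsets_le)
  finally have cS: "card ?S \<le> card T ^ (k - 1)" .
  have "star_pairs k E T z \<subseteq> (\<lambda>(e, s). {e, s}) ` (E \<times> ?S)"
    by (auto simp: star_pairs_def)
  hence "card (star_pairs k E T z) \<le> card (E \<times> ?S)"
    using finE finS by (meson card_image_le card_mono finite_SigmaI finite_imageI le_trans)
  also have "\<dots> \<le> card E * card T ^ (k - 1)" using cS by (simp add: card_cartesian_product)
  finally show ?thesis .
qed

text \<open>An edge in \<open>star_pairs k E T z\<close> determines \<open>z\<close>, the only element outside \<open>T\<close> that it involves;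
  hence different candidates succeed independently.\<close>
lemma disjoint_family_star_pairs:
  assumes "E \<subseteq> nsets T k"
  shows "disjoint_family_on (star_pairs k E T) (U - T)"
proof -
  have False if zz: "z \<in> U - T" "z' \<in> U - T" "z \<noteq> z'" "e \<in> E" "s \<in> nsets (insert z T) k" "z \<in> s"
    "e' \<in> E" "s' \<in> nsets (insert z' T) k" "z' \<in> s'" "{e, s} = {e', s'}" for z z' e s e' s'
  proof -
    have "z \<notin> e'" "z \<notin> s'" using zz assms by (auto simp: nsets_def)
    thus False using zz by auto
  qed
  thus ?thesis
    unfolding disjoint_family_on_def star_pairs_def
    by (intro ballI impI equals0I) (elim IntE CollectE exE conjE, metis)
qed

lemma prob_not_absorbed_le:
  assumes "k \<ge> 1" "n \<ge> 1" "T \<subseteq> {1..n}" "2 * card T \<le> n" "E \<subseteq> nsets T k"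
    "real (card E * card T ^ (k - 1)) \<le> log 2 n / 2"
  shows "measure_pmf.prob (random_kneser_graph n k (1/2))
           {X. \<forall>z\<in>{1..n} - T. star_pairs k E T z \<inter> edges X \<noteq> {}} \<le> exp (- sqrt n / 2)"
proof -
  let ?Q = "star_pairs k E T" and ?I = "{1..n} - T"
  have finT: "finite T" using assms finite_subset by auto
  have "measure_pmf.prob (random_kneser_graph n k (1/2)) {X. \<forall>z\<in>?I. ?Q z \<inter> edges X \<noteq> {}}
      = (\<Prod>z\<in>?I. 1 - (1/2) ^ card (?Q z))"
    unfolding random_kneser_graph_def
    using star_pairs_subset_kneser[OF assms(3,5)] disjoint_family_star_pairs[OF assms(5)]
    by (intro prob_no_block_absent finite_edges_kneser_graph) auto
  also have "\<dots> \<le> (\<Prod>z\<in>?I. exp (- (1 / sqrt n)))"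
  proof (intro prod_mono conjI)
    fix z assume z: "z \<in> ?I"
    show "0 \<le> 1 - (1/2::real) ^ card (?Q z)" by (simp add: power_le_one)
    have "real (card (?Q z)) \<le> log 2 n / 2"
      using card_star_pairs_le[OF finT _ assms(5,1), of z] z assms(6) by (meson DiffD2 of_nat_mono order_trans)
    hence "2 powr (- (log 2 n / 2)) \<le> 2 powr (- real (card (?Q z)))" by (intro powr_mono) auto
    also have "\<dots> = (1/2) ^ card (?Q z)" by (simp add: powr_minus powr_realpow power_one_over divide_simps)
    also have "2 powr (- (log 2 n / 2)) = (2 powr log 2 n) powr (- (1/2))"
      by (simp add: powr_powr)
    also have "\<dots> = 1 / sqrt n" using assms(2) by (simp add: powr_minus powr_half_sqrt divide_simps)
    finally have "1 - (1/2) ^ card (?Q z) \<le> 1 + (- (1 / sqrt n))" by simp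
    also have "\<dots> \<le> exp (- (1 / sqrt n))" by (rule exp_ge_add_one_self)
    finally show "1 - (1/2) ^ card (?Q z) \<le> exp (- (1 / sqrt n))" .
  qed
  also have "\<dots> = exp (- (real (card ?I) / sqrt n))"
    by (simp add: exp_of_nat_mult[symmetric])
  also have "\<dots> \<le> exp (- sqrt n / 2)"
  proof -
    have "card ?I = n - card T" using assms(3) finT by (simp add: card_Diff_subset)
    hence "real (card ?I) \<ge> n / 2" using assms(4) by linarith
    hence "real (card ?I) / sqrt n \<ge> (n / 2) / sqrt n" by (intro divide_right_mono) auto
    also have "(n / 2) / sqrt n = sqrt n / 2" using real_div_sqrt[of n] by simp
    finally show ?thesis by simp
  qed
  finally show ?thesis .
qed

text \<open>There are only \<open>n powr O(L ^ 2)\<close> situations \<open>(T, E)\<close>, each failing with probability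
  \<open>exp (- sqrt n / 2)\<close>.\<close>
lemma asymp_almost_surely_absorbing:
  fixes D :: "nat \<Rightarrow> nat"
  assumes "k \<ge> 2" and D: "\<forall>\<^sub>F n in sequentially. real (D n) \<le> log 2 n"
  shows "asymp_almost_surely (\<lambda>n. random_kneser_graph n k (1/2)) (\<lambda>n X. absorbing n k (D n) X)"
proof (rule asymp_almost_surelyI)
  let ?\<epsilon> = "\<lambda>n::nat. real n powr ((log 2 n)\<^sup>2 + 2) * exp (- sqrt n / 2)"
  show "?\<epsilon> \<longlonglongrightarrow> 0" by real_asymp
  have "\<forall>\<^sub>F n::nat in sequentially. log 2 n + 1 \<le> n / 2" by real_asymp
  moreover have "\<forall>\<^sub>F n::nat in sequentially. real (k + 1) \<le> log 2 n" by real_asymp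
  ultimately show "\<forall>\<^sub>F n in sequentially. measure_pmf.prob (random_kneser_graph n k (1/2))
      {X. \<not> absorbing n k (D n) X} \<le> ?\<epsilon> n"
    using D eventually_ge_at_top[of 2]
  proof eventually_elim
    case (elim n)
    define l where "l = nat \<lfloor>log 2 n\<rfloor>"
    have l: "real l \<le> log 2 n" "D n \<le> l" "l + 1 \<le> n"
      using elim by (auto simp: l_def le_nat_floor) linarith+
    let ?J = "\<lambda>i a. SIGMA T:nsets {1..n} i. nsets (nsets T k) a"
    define I where "I = {(T, E). T \<subseteq> {1..n} \<and> card T < D n \<and> E \<subseteq> nsets T k
      \<and> real (card E * card T ^ (k - 1)) \<le> log 2 n / 2}"
    have sub: "I \<subseteq> (\<Union>i\<in>{..<D n}. \<Union>a\<in>{..l}. ?J i a)"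
    proof
      fix p assume "p \<in> I"
      then obtain T E where p: "p = (T, E)" "T \<subseteq> {1..n}" "card T < D n" "E \<subseteq> nsets T k"
        "real (card E * card T ^ (k - 1)) \<le> log 2 n / 2" by (auto simp: I_def)
      have fT: "finite T" using p(2) finite_subset by auto
      have fE: "finite E" using finite_subset[OF p(4)] fT finite_imp_finite_nsets by blast
      have "card E \<le> l"
      proof (cases "T = {}")
        case True
        hence "nsets T k = {}" using assms(1) by (intro nsets_eq_empty) auto
        thus ?thesis using p(4) by simp
      next
        case False
        hence "card E * 1 \<le> card E * card T ^ (k - 1)" using fT
          by (intro mult_le_mono2) (simp add: Suc_leI card_gt_0_iff)
        hence "real (card E) \<le> real (card E * card T ^ (k - 1))" by (simp only: of_nat_le_iff)
        also have "\<dots> \<le> log 2 n" using p(5) elim by (simp add: field_simps)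
        finally show ?thesis unfolding l_def by (rule le_nat_floor)
      qed
      thus "p \<in> (\<Union>i\<in>{..<D n}. \<Union>a\<in>{..l}. ?J i a)" using p fT fE by (auto simp: nsets_def)
    qed
    have finJ: "finite (?J i a)" for i a
    proof (intro finite_SigmaI finite_imp_finite_nsets)
      show "finite a" if "a \<in> nsets {1..n} i" for a using that by (auto simp: nsets_def)
    qed auto
    have cardJ: "card (?J i a) \<le> n ^ ((k + 1) * l)" if "i < D n" "a \<le> l" for i a
    proof -
      have "card (?J i a) = (\<Sum>T\<in>nsets {1..n} i. card (nsets (nsets T k) a))"
      proof (intro card_SigmaI ballI finite_imp_finite_nsets)
        show "finite a" if "a \<in> nsets {1..n} i" for a using that by (auto simp: nsets_def)
      qed auto
      also have "\<dots> \<le> (\<Sum>T\<in>nsets {1..n} i. n ^ (k * a))"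
      proof (rule sum_mono)
        fix T assume "T \<in> nsets {1..n} i"
        hence "card T \<le> n" using card_mono[of "{1..n}" T] by (auto simp: nsets_def)
        hence "card (nsets T k) \<le> n ^ k" using card_nsets_le[of T k] power_mono[of "card T" n k] by simp
        hence "card (nsets T k) ^ a \<le> (n ^ k) ^ a" by (intro power_mono) auto
        thus "card (nsets (nsets T k) a) \<le> n ^ (k * a)"
          using card_nsets_le[of "nsets T k" a] by (simp add: power_mult)
      qed
      also have "\<dots> \<le> n ^ i * n ^ (k * a)"
        using card_nsets_le[of "{1..n}" i] by simp
      also have "\<dots> = n ^ (i + k * a)" by (simp add: power_add)
      also have "\<dots> \<le> n ^ ((k + 1) * l)"
      proof (rule power_increasing)
        have "i + k * a \<le> l + k * l" using that l by (intro add_mono mult_le_mono) auto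
        thus "i + k * a \<le> (k + 1) * l" by (simp add: algebra_simps)
      qed (use elim in auto)
      finally show ?thesis .
    qed
    have finI: "finite I" by (rule finite_subset[OF sub]) (intro finite_UN_I finJ finite_lessThan finite_atMost)
    have "card I \<le> card (\<Union>i\<in>{..<D n}. \<Union>a\<in>{..l}. ?J i a)"
      by (rule card_mono[OF _ sub]) (intro finite_UN_I finJ finite_lessThan finite_atMost)
    also have "\<dots> \<le> (\<Sum>i<D n. card (\<Union>a\<in>{..l}. ?J i a))" by (intro card_UN_le) auto
    also have "\<dots> \<le> (\<Sum>i<D n. \<Sum>a\<le>l. card (?J i a))" by (intro sum_mono card_UN_le) auto
    also have "\<dots> \<le> (\<Sum>i<D n. \<Sum>a\<le>l. n ^ ((k + 1) * l))" by (intro sum_mono cardJ) auto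
    also have "\<dots> = D n * (Suc l * n ^ ((k + 1) * l))" by simp
    also have "\<dots> \<le> n * (n * n ^ ((k + 1) * l))" using l by (intro mult_le_mono) auto
    finally have "real (card I) \<le> real (n * (n * n ^ ((k + 1) * l)))" by (simp only: of_nat_le_iff)
    also have "\<dots> = real n powr (real ((k + 1) * l) + 2)"
    proof -
      have "real (n * (n * n ^ ((k + 1) * l))) = real n ^ ((k + 1) * l + 2)"
        by (simp add: power_add power2_eq_square)
      also have "\<dots> = real n powr real ((k + 1) * l + 2)"
        using elim by (intro powr_realpow[symmetric]) auto
      finally show ?thesis by (simp only: of_nat_add of_nat_numeral)
    qed
    also have "\<dots> \<le> real n powr ((log 2 n)\<^sup>2 + 2)"
    proof (intro powr_mono add_right_mono)
      have "real ((k + 1) * l) = real (k + 1) * real l" by (simp only: of_nat_mult)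
      also have "\<dots> \<le> log 2 n * log 2 n" using elim l by (intro mult_mono) auto
      finally show "real ((k + 1) * l) \<le> (log 2 n)\<^sup>2" by (simp add: power2_eq_square)
    qed (use elim in auto)
    finally have cardI: "real (card I) \<le> real n powr ((log 2 n)\<^sup>2 + 2)" .
    let ?P = "\<lambda>(T, E) X. \<forall>z\<in>{1..n} - T. star_pairs k E T z \<inter> edges X \<noteq> {}"
    have "measure_pmf.prob (random_kneser_graph n k (1/2)) {X. \<not> absorbing n k (D n) X}
      = measure_pmf.prob (random_kneser_graph n k (1/2)) {X. \<exists>i\<in>I. ?P i X}"
      by (intro arg_cong[where f="measure_pmf.prob _"]) (auto simp: absorbing_def I_def)
    also have "\<dots> \<le> real (card I) * exp (- sqrt n / 2)"
    proof (rule prob_union_bound[OF finI])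
      fix p assume "p \<in> I"
      then obtain T E where p: "p = (T, E)" "T \<subseteq> {1..n}" "card T < D n" "E \<subseteq> nsets T k"
        "real (card E * card T ^ (k - 1)) \<le> log 2 n / 2" by (auto simp: I_def)
      have "2 * card T \<le> n" using p elim by linarith
      thus "measure_pmf.prob (random_kneser_graph n k (1/2)) {X. ?P p X} \<le> exp (- sqrt n / 2)"
        using prob_not_absorbed_le[of k n T E] p elim assms by simp
    qed
    also have "\<dots> \<le> ?\<epsilon> n" using cardI by (intro mult_right_mono) auto
    finally show ?case .
  qed
qed

text \<open>The greedy construction of the upper bound. The number \<open>s i\<close> says how many sets of the core are
  hidden in the class created when \<open>i\<close> elements have been treated. The sets hidden in one class
  must be independent as well; they are therefore chosen through a common element \<open>y\<close> of the core. A step may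
  hide fewer than \<open>s i\<close> sets only if it finishes off all remaining sets through \<open>y\<close>, which happens at most
  \<open>d\<close> times; the term \<open>s d * d\<close> pays for these steps.\<close>
lemma colorable_on_if_absorbing:
  assumes k: "k \<ge> 1" and X: "edges X \<subseteq> edges (kneser_graph n k)" and abs: "absorbing n k D X"
    and s: "\<And>i. d \<le> i \<Longrightarrow> i < D \<Longrightarrow> real (s i * i ^ (k - 1)) \<le> log 2 n / 2"
    and anti: "\<And>i. d \<le> i \<Longrightarrow> s i \<le> s d"
    and d: "d \<le> n" "d \<le> D"
    and big: "d ^ k + s d * d \<le> (\<Sum>i\<in>{d..<D}. s i)"
  shows "colorable_on X (nsets {1..n} k) (n - d)"
proof -
  define Y where "Y = {1..d}"
  have Y: "Y \<subseteq> {1..n}" "card Y = d" using d by (auto simp: Y_def)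
  have meet: "{u, v} \<notin> edges X" if "u \<inter> v \<noteq> {}" for u v
    using that X by (meson in_edges_kneser_iff subsetD)
  have step: "colorable_on X A' (Suc m)"
    if "colorable_on X A m" "E \<subseteq> nsets T k" "\<forall>e\<in>E. y \<in> e" "star_pairs k E T z \<inter> edges X = {}"
      "A' \<subseteq> A \<union> ({t \<in> nsets (insert z T) k. z \<in> t} \<union> E)" for A A' m E T y z
  proof (rule colorable_on_Suc[OF that(1) _ that(5)])
    have mix: "{e, t} \<notin> edges X" if "e \<in> E" "t \<in> nsets (insert z T) k" "z \<in> t" for e t
    proof (cases "e \<inter> t = {}")
      case True
      hence "{e, t} \<in> star_pairs k E T z" using that unfolding star_pairs_def by blast
      thus ?thesis using \<open>star_pairs k E T z \<inter> edges X = {}\<close> by blast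
    qed (rule meet)
    show "{u, v} \<notin> edges X" if uv: "u \<in> {t \<in> nsets (insert z T) k. z \<in> t} \<union> E"
      "v \<in> {t \<in> nsets (insert z T) k. z \<in> t} \<union> E" for u v
    proof -
      consider "z \<in> u" "z \<in> v" | "u \<in> E" "v \<in> E" | "u \<in> E" "v \<in> nsets (insert z T) k" "z \<in> v"
        | "v \<in> E" "u \<in> nsets (insert z T) k" "z \<in> u" using uv by blast
      thus ?thesis
      proof cases
        case 1 thus ?thesis by (intro meet) auto
      next
        case 2 thus ?thesis using \<open>\<forall>e\<in>E. y \<in> e\<close> by (intro meet) auto
      next
        case 3 thus ?thesis using mix by blast
      next
        case 4 thus ?thesis using mix[of v u] by (simp add: insert_commute)
      qed
    qed
  qed
  \<comment> \<open>\<open>Rem\<close> is the family of core sets not hidden yet. The potential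
    \<open>card Rem + s d * card (\<Union>Rem)\<close> decreases by at least \<open>s i\<close> in step \<open>i\<close>.\<close>
  have grow: "\<exists>T Rem. Y \<subseteq> T \<and> T \<subseteq> {1..n} \<and> card T = d + j \<and> Rem \<subseteq> nsets Y k
      \<and> colorable_on X (nsets T k - Rem) j
      \<and> (Rem = {} \<or> card Rem + s d * card (\<Union>Rem) + (\<Sum>i\<in>{d..<d+j}. s i) \<le> d ^ k + s d * d)"
    if "d + j \<le> D" for j
    using that
  proof (induction j)
    case 0
    have "card (nsets Y k) \<le> d ^ k" using card_nsets_le[of Y k] Y by simp
    moreover have "card (\<Union>(nsets Y k)) \<le> d"
      using card_mono[of Y "\<Union>(nsets Y k)"] Y by (auto simp: nsets_def Y_def)
    ultimately show ?case
      using Y by (intro exI[of _ Y] exI[of _ "nsets Y k"]) (auto simp: colorable_on_def intro!: add_mono)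
  next
    case (Suc j)
    then obtain T Rem where T: "Y \<subseteq> T" "T \<subseteq> {1..n}" "card T = d + j" "Rem \<subseteq> nsets Y k"
      "colorable_on X (nsets T k - Rem) j"
      "Rem = {} \<or> card Rem + s d * card (\<Union>Rem) + (\<Sum>i\<in>{d..<d+j}. s i) \<le> d ^ k + s d * d"
      by auto
    have finRem: "finite Rem" using finite_subset[OF T(4)] by (simp add: Y_def finite_imp_finite_nsets)
    have RemY: "\<Union>Rem \<subseteq> Y" using T(4) by (auto simp: nsets_def)
    hence finU: "finite (\<Union>Rem)" using finite_subset by (auto simp: Y_def)
    have "\<exists>E y. E \<subseteq> Rem \<and> (\<forall>e\<in>E. y \<in> e) \<and> card E \<le> s (d + j) \<and>
      (Rem - E = {} \<or> card (Rem - E) + s d * card (\<Union>(Rem - E)) + (\<Sum>i\<in>{d..<d+Suc j}. s i) \<le> d ^ k + s d * d)"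
    proof (cases "Rem = {}")
      case False
      then obtain e0 where "e0 \<in> Rem" by blast
      moreover from this have "card e0 = k" "finite e0" using T(4) by (auto simp: nsets_def)
      ultimately obtain y where y: "y \<in> \<Union>Rem" using k by (metis UnionI all_not_in_conv card.empty not_one_le_zero)
      define R where "R = {e \<in> Rem. y \<in> e}"
      have le: "card Rem + s d * card (\<Union>Rem) + (\<Sum>i\<in>{d..<d+j}. s i) \<le> d ^ k + s d * d" using T(6) False by blast
      show ?thesis
      proof (cases "card R \<le> s (d + j)")
        case True
        have "\<Union>(Rem - R) \<subset> \<Union>Rem" using y by (auto simp: R_def)
        hence "Suc (card (\<Union>(Rem - R))) \<le> card (\<Union>Rem)" using finU by (simp add: psubset_card_mono Suc_leI)
        hence "s d * Suc (card (\<Union>(Rem - R))) \<le> s d * card (\<Union>Rem)" by (rule mult_le_mono2)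
        moreover have "s (d + j) \<le> s d" by (intro anti) auto
        moreover have "card (Rem - R) \<le> card Rem" using finRem by (intro card_mono) auto
        ultimately show ?thesis using le True by (intro exI[of _ R] exI[of _ y]) (auto simp: R_def)
      next
        case False
        then obtain E where E: "E \<subseteq> R" "card E = s (d + j)" by (meson nat_le_linear obtain_subset_with_card_n)
        have ER: "E \<subseteq> Rem" using E by (auto simp: R_def)
        have "card (Rem - E) = card Rem - card E" "card E \<le> card Rem"
          using ER finRem by (simp_all add: card_Diff_subset card_mono finite_subset[OF ER])
        moreover have "card (\<Union>(Rem - E)) \<le> card (\<Union>Rem)" using finU by (intro card_mono) auto
        hence "s d * card (\<Union>(Rem - E)) \<le> s d * card (\<Union>Rem)" by (rule mult_le_mono2)
        moreover have "(\<Sum>i\<in>{d..<d+Suc j}. s i) = (\<Sum>i\<in>{d..<d+j}. s i) + s (d + j)" by simp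
        ultimately have "card (Rem - E) + s d * card (\<Union>(Rem - E)) + (\<Sum>i\<in>{d..<d+Suc j}. s i) \<le> d ^ k + s d * d"
          using le E(2) by linarith
        thus ?thesis using E by (intro exI[of _ E] exI[of _ y] conjI disjI2) (auto simp: R_def)
      qed
    qed auto
    then obtain E y where E: "E \<subseteq> Rem" "\<forall>e\<in>E. y \<in> e" "card E \<le> s (d + j)"
      "Rem - E = {} \<or> card (Rem - E) + s d * card (\<Union>(Rem - E)) + (\<Sum>i\<in>{d..<d+Suc j}. s i) \<le> d ^ k + s d * d"
      by blast
    have ET: "E \<subseteq> nsets T k" using E(1) T(1,4) nsets_mono by blast
    have "card E * card T ^ (k - 1) \<le> s (d + j) * (d + j) ^ (k - 1)"
      using E(3) T(3) by simp
    hence "real (card E * card T ^ (k - 1)) \<le> real (s (d + j) * (d + j) ^ (k - 1))" by (simp only: of_nat_le_iff)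
    also have "\<dots> \<le> log 2 n / 2" using Suc.prems by (intro s) auto
    finally obtain z where z: "z \<in> {1..n} - T" "star_pairs k E T z \<inter> edges X = {}"
      using abs T(2,3) ET Suc.prems unfolding absorbing_def by (metis Suc_le_lessD add_Suc_right)
    have "nsets (insert z T) k - (Rem - E) \<subseteq> (nsets T k - Rem) \<union> ({t \<in> nsets (insert z T) k. z \<in> t} \<union> E)"
      by (auto simp: nsets_def)
    hence "colorable_on X (nsets (insert z T) k - (Rem - E)) (Suc j)"
      by (rule step[OF T(5) ET E(2) z(2)])
    moreover have "card (insert z T) = d + Suc j" using z T(2,3) finite_subset[OF T(2)] by auto
    ultimately show ?case using T E(4) z
      by (intro exI[of _ "insert z T"] exI[of _ "Rem - E"]) auto
  qed
  obtain T where T: "T \<subseteq> {1..n}" "card T = D" "colorable_on X (nsets T k) (D - d)"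
  proof -
    obtain T Rem where T: "T \<subseteq> {1..n}" "card T = D" "Rem \<subseteq> nsets Y k" "colorable_on X (nsets T k - Rem) (D - d)"
      "Rem = {} \<or> card Rem + s d * card (\<Union>Rem) + (\<Sum>i\<in>{d..<D}. s i) \<le> d ^ k + s d * d"
      using grow[of "D - d"] d by auto
    have "finite Rem" using finite_subset[OF T(3)] by (simp add: Y_def finite_imp_finite_nsets)
    hence "Rem = {}" using T(5) big by (cases "card Rem = 0") auto
    thus ?thesis using T that by auto
  qed
  \<comment> \<open>All remaining elements get their own stars; nothing has to be hidden any more.\<close>
  have "\<exists>T. T \<subseteq> {1..n} \<and> card T = D + j \<and> colorable_on X (nsets T k) (D + j - d)" if "D + j \<le> n" for j
    using that
  proof (induction j)
    case 0
    thus ?case using T by auto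
  next
    case (Suc j)
    then obtain T where T: "T \<subseteq> {1..n}" "card T = D + j" "colorable_on X (nsets T k) (D + j - d)" by auto
    have "T \<noteq> {1..n}" using T(2) Suc.prems by auto
    then obtain z where z: "z \<in> {1..n} - T" using T(1) by blast
    have "colorable_on X (nsets (insert z T) k) (Suc (D + j - d))"
      by (rule step[OF T(3), of "{}"]) (auto simp: nsets_def star_pairs_def)
    moreover have "card (insert z T) = D + Suc j" using z T(1,2) finite_subset[OF T(1)] by auto
    moreover have "Suc (D + j - d) = D + Suc j - d" using d by simp
    ultimately show ?case using T z by (intro exI[of _ "insert z T"]) auto
  qed
  moreover have "D \<le> n" using T card_mono[of "{1..n}" T] by auto
  ultimately obtain T' where T': "T' \<subseteq> {1..n}" "card T' = n" "colorable_on X (nsets T' k) (n - d)"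
    by (metis le_add_diff_inverse order_refl)
  have "T' = {1..n}" using T' by (intro card_subset_eq) auto
  thus ?thesis using T' by simp
qed

section \<open>Lower bound: two almost sure properties\<close>

definition mono_pairs :: "'a set set \<Rightarrow> ('a set \<Rightarrow> nat) \<Rightarrow> 'a set set set" where
  "mono_pairs D c = {{a, b} | a b. a \<in> D \<and> b \<in> D \<and> a \<inter> b = {} \<and> c a = c b}"

text \<open>Each monochromatic disjoint pair halves the probability that a partial colouring is proper, and the
  right-hand side exceeds the entropy of the choice of \<open>S\<close>, \<open>D\<close> and \<open>c\<close>: a
  set \<open>S\<close> costs \<open>card S * L\<close> bits, and each coloured set costs \<open>k * log 2 (card S)\<close> bits for
  the set and \<open>log 2 (card S)\<close> bits for its colour.\<close>
definition conflict_free_sparse :: "nat \<Rightarrow> nat \<Rightarrow> nat set ugraph \<Rightarrow> bool" where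
  "conflict_free_sparse n k X \<longleftrightarrow>
     (\<forall>S D c. S \<subseteq> {1..n} \<and> k \<le> card S \<and> D \<subseteq> nsets S k \<and> c \<in> D \<rightarrow> {..<card S}
        \<and> mono_pairs D c \<inter> edges X = {}
      \<longrightarrow> real (card (mono_pairs D c)) < 4 * card S * log 2 n + (k + 1) * card D * log 2 (card S))"

lemma mono_pairs_subset_kneser:
  assumes "D \<subseteq> nsets {1..n} k"
  shows "mono_pairs D c \<subseteq> edges (kneser_graph n k)"
  using assms by (auto simp: mono_pairs_def in_edges_kneser_iff)

lemma mono_pairs_cong:
  assumes "\<And>a b. a \<in> D \<Longrightarrow> b \<in> D \<Longrightarrow> c a = c b \<longleftrightarrow> c' a = c' b"
  shows "mono_pairs D c = mono_pairs D c'"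
  unfolding mono_pairs_def using assms by blast

text \<open>Union bound over \<open>(S, D, c)\<close>, grouped by \<open>m = card S\<close> and \<open>a = card D\<close>: in each group the number of choices
  times the probability of a violation is at most \<open>1 / n ^ (3 * m)\<close>.\<close>
lemma asymp_almost_surely_conflict_free_sparse:
  assumes k: "k \<ge> 2"
  shows "asymp_almost_surely (\<lambda>n. random_kneser_graph n k (1/2)) (\<lambda>n X. conflict_free_sparse n k X)"
proof (rule asymp_almost_surelyI)
  show "(\<lambda>n::nat. 2 / real n) \<longlonglongrightarrow> 0" by real_asymp
  show "\<forall>\<^sub>F n in sequentially. measure_pmf.prob (random_kneser_graph n k (1/2))
      {X. \<not> conflict_free_sparse n k X} \<le> 2 / real n"
    using eventually_ge_at_top[of 2]
  proof eventually_elim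
    case (elim n)
    let ?M = "random_kneser_graph n k (1/2)"
    let ?J = "\<lambda>(m, a). SIGMA S:nsets {1..n} m. SIGMA D:nsets (nsets S k) a. D \<rightarrow>\<^sub>E {..<m}"
    let ?bad = "\<lambda>(S, D, c) X. mono_pairs D c \<inter> edges X = {} \<and>
      4 * card S * log 2 n + (k + 1) * card D * log 2 (card S) \<le> real (card (mono_pairs D c))"
    let ?O = "{k..n} \<times> {..n ^ k}"
    have "{X. \<not> conflict_free_sparse n k X} \<subseteq> {X. \<exists>p\<in>?O. \<exists>i\<in>?J p. ?bad i X}"
    proof
      fix X assume "X \<in> {X. \<not> conflict_free_sparse n k X}"
      then obtain S D c where S: "S \<subseteq> {1..n}" "k \<le> card S" "D \<subseteq> nsets S k" "c \<in> D \<rightarrow> {..<card S}"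
        "mono_pairs D c \<inter> edges X = {}"
        "4 * card S * log 2 n + (k + 1) * card D * log 2 (card S) \<le> real (card (mono_pairs D c))"
        unfolding conflict_free_sparse_def mem_Collect_eq not_all not_imp not_less by blast
      have fS: "finite S" "card S \<le> n" using S(1) finite_subset card_mono[of "{1..n}" S] by auto
      have fD: "finite D" using finite_subset[OF S(3)] fS by (simp add: finite_imp_finite_nsets)
      have "card D \<le> card (nsets S k)" using S(3) fS by (intro card_mono finite_imp_finite_nsets)
      also have "\<dots> \<le> card S ^ k" by (rule card_nsets_le)
      also have "\<dots> \<le> n ^ k" using fS by (intro power_mono) auto
      finally have "(card S, card D) \<in> ?O" using S fS by auto
      moreover have "(S, D, restrict c D) \<in> ?J (card S, card D)"
        using S fS fD by (auto simp: nsets_def)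
      moreover have "mono_pairs D (restrict c D) = mono_pairs D c" by (rule mono_pairs_cong) auto
      hence "?bad (S, D, restrict c D) X" using S by simp
      ultimately show "X \<in> {X. \<exists>p\<in>?O. \<exists>i\<in>?J p. ?bad i X}" by blast
    qed
    hence "measure_pmf.prob ?M {X. \<not> conflict_free_sparse n k X} \<le> measure_pmf.prob ?M {X. \<exists>p\<in>?O. \<exists>i\<in>?J p. ?bad i X}"
      by (intro measure_pmf.finite_measure_mono) auto
    also have "\<dots> \<le> real (card ?O) * (1 / real n ^ (3 * k))"
    proof (rule prob_union_bound)
      fix p assume "p \<in> ?O"
      then obtain m a where p: "p = (m, a)" "k \<le> m" "m \<le> n" by auto
      have fin1: "finite (nsets (nsets S k) a)" "finite (D \<rightarrow>\<^sub>E {..<m})" if "S \<in> nsets {1..n} m" "D \<in> nsets (nsets S k) a" for S D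
        using that by (auto simp: nsets_def intro!: finite_imp_finite_nsets[unfolded nsets_def] finite_PiE)
      have fin1': "finite (nsets (nsets S k) a)" if "S \<in> nsets {1..n} m" for S
        using that by (auto simp: nsets_def intro!: finite_imp_finite_nsets[unfolded nsets_def])
      have finJ: "finite (?J p)" unfolding p prod.case
        by (intro finite_SigmaI fin1' fin1 finite_imp_finite_nsets finite_atLeastAtMost)
      have "card (?J p) = (\<Sum>S\<in>nsets {1..n} m. \<Sum>D\<in>nsets (nsets S k) a. card (D \<rightarrow>\<^sub>E {..<m}))"
        unfolding p prod.case
        by (subst card_SigmaI)
          (intro ballI sum.cong refl card_SigmaI finite_SigmaI fin1' fin1 finite_imp_finite_nsets finite_atLeastAtMost; assumption)+
      also have "\<dots> = (\<Sum>S\<in>nsets {1..n} m. \<Sum>D\<in>nsets (nsets S k) a. m ^ a)"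
        by (intro sum.cong refl) (auto simp: nsets_def card_PiE)
      also have "\<dots> = (\<Sum>S\<in>nsets {1..n} m. card (nsets (nsets S k) a) * m ^ a)" by simp
      also have "\<dots> \<le> (\<Sum>S\<in>nsets {1..n} m. m ^ (k * a) * m ^ a)"
      proof (intro sum_mono mult_right_mono)
        fix S assume "S \<in> nsets {1..n} m"
        hence "card (nsets S k) \<le> m ^ k" using card_nsets_le[of S k] by (simp add: nsets_def)
        hence "card (nsets S k) ^ a \<le> (m ^ k) ^ a" by (intro power_mono) auto
        thus "card (nsets (nsets S k) a) \<le> m ^ (k * a)"
          using card_nsets_le[of "nsets S k" a] by (simp add: power_mult)
      qed auto
      also have "\<dots> = card (nsets {1..n} m) * m ^ ((k + 1) * a)" by (simp add: power_add mult_ac)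
      also have "\<dots> \<le> n ^ m * m ^ ((k + 1) * a)" using card_nsets_le[of "{1..n}" m] by (intro mult_right_mono) auto
      finally have "real (card (?J p)) \<le> real (n ^ m * m ^ ((k + 1) * a))" by (simp only: of_nat_le_iff)
      hence cardJ: "real (card (?J p)) \<le> real n ^ m * real m ^ ((k + 1) * a)" by simp
      have "measure_pmf.prob ?M {X. \<exists>i\<in>?J p. ?bad i X} \<le> real (card (?J p)) * (1 / (real n ^ (4 * m) * real m ^ ((k + 1) * a)))"
      proof (rule prob_union_bound[OF finJ])
        fix i assume "i \<in> ?J p"
        then obtain S D c where i: "i = (S, D, c)" "S \<in> nsets {1..n} m" "D \<in> nsets (nsets S k) a"
          unfolding p by auto
        have cards: "card S = m" "card D = a" and "S \<subseteq> {1..n}" "D \<subseteq> nsets S k"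
          using i by (simp_all add: nsets_def)
        hence DS: "D \<subseteq> nsets {1..n} k" using nsets_mono by blast
        show "measure_pmf.prob ?M {X. ?bad i X} \<le> 1 / (real n ^ (4 * m) * real m ^ ((k + 1) * a))"
        proof (cases "4 * card S * log 2 n + (k + 1) * card D * log 2 (card S) \<le> real (card (mono_pairs D c))")
          case True
          have "measure_pmf.prob ?M {X. ?bad i X} = measure_pmf.prob ?M {X. \<forall>e\<in>mono_pairs D c. e \<in> edges X \<longleftrightarrow> False}"
            using True by (intro arg_cong[where f="measure_pmf.prob _"]) (auto simp: i)
          also have "\<dots> = (1/2) ^ card (mono_pairs D c)"
            unfolding random_kneser_graph_def
            by (rule prob_random_subgraph_half_agree[OF finite_edges_kneser_graph mono_pairs_subset_kneser[OF DS]])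
          also have "\<dots> = 2 powr (- real (card (mono_pairs D c)))"
            by (simp add: powr_minus powr_realpow power_one_over divide_simps)
          also have "\<dots> \<le> 2 powr (- (real (4 * m) * log 2 n + real ((k + 1) * a) * log 2 m))"
            using True cards by (intro powr_mono) (auto simp: mult_ac)
          also have "\<dots> = 1 / ((2 powr log 2 n) powr real (4 * m) * (2 powr log 2 m) powr real ((k + 1) * a))"
            unfolding powr_powr powr_minus powr_add minus_add_distrib
            by (simp add: divide_inverse mult_ac)
          also have "2 powr log 2 n = real n" using elim by simp
          also have "2 powr log 2 m = real m" using p k by simp
          also have "real n powr real (4 * m) = real n ^ (4 * m)" using elim by (intro powr_realpow) auto
          also have "real m powr real ((k + 1) * a) = real m ^ ((k + 1) * a)" using p k by (intro powr_realpow) auto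
          finally show ?thesis .
        next
          case False
          hence "{X. ?bad i X} = {}" by (auto simp: i)
          thus ?thesis by (simp only: measure_empty) simp
        qed
      qed
      also have "\<dots> \<le> (real n ^ m * real m ^ ((k + 1) * a)) * (1 / (real n ^ (4 * m) * real m ^ ((k + 1) * a)))"
        by (intro mult_right_mono cardJ) auto
      also have "\<dots> = 1 / real n ^ (3 * m)"
      proof -
        have "real n ^ (4 * m) = real n ^ m * real n ^ (3 * m)" by (simp flip: power_add)
        moreover have "real n ^ m > 0" "real m ^ ((k + 1) * a) > 0" using elim p k by simp_all
        ultimately show ?thesis by (simp add: field_simps)
      qed
      also have "\<dots> \<le> 1 / real n ^ (3 * k)" using elim p by (intro divide_left_mono power_increasing) auto
      finally show "measure_pmf.prob ?M {X. \<exists>i\<in>?J p. ?bad i X} \<le> 1 / real n ^ (3 * k)" .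
    qed auto
    also have "\<dots> \<le> 2 / real n"
    proof -
      have "card ?O \<le> n * (n ^ k + n ^ k)" using elim k
        by (auto simp: card_cartesian_product simp del: mult_Suc_right intro!: mult_le_mono)
      also have "\<dots> = 2 * n ^ (k + 1)" by (simp add: algebra_simps)
      finally have "real (card ?O) \<le> real (2 * n ^ (k + 1))" by (simp only: of_nat_le_iff)
      hence "real (card ?O) * (1 / real n ^ (3 * k)) \<le> 2 * real n ^ (k + 1) * (1 / real n ^ (3 * k))"
        by (intro mult_right_mono) auto
      also have "\<dots> = 2 * real n ^ (k + 1) / real n ^ (3 * k)" by simp
      also have "\<dots> \<le> 2 * real n ^ (k + 1) / real n ^ (k + 2)"
        using elim k by (intro divide_left_mono power_increasing) auto
      also have "\<dots> = 2 / real n" using elim by (simp add: field_simps)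
      finally show ?thesis .
    qed
    finally show ?case .
  qed
qed

text \<open>Think of \<open>x j\<close> as the centre of the \<open>j\<close>-th colour class and of \<open>b j\<close> as a member of that class missing
  the centre. In a proper colouring, a blocked set \<open>s\<close> cannot lie in the star part of any
  class.\<close>
definition witness_blocked :: "nat \<Rightarrow> nat set \<Rightarrow> nat \<Rightarrow> (nat \<Rightarrow> nat) \<Rightarrow> (nat \<Rightarrow> nat set) \<Rightarrow> nat set ugraph \<Rightarrow> nat set set" where
  "witness_blocked k S r x b X = {s \<in> nsets S k. \<forall>j<r. x j \<in> s \<longrightarrow> {s, b j} \<in> edges X}"

text \<open>The condition on \<open>card S\<close> makes \<open>card S ^ k\<close> larger than the entropy \<open>card S * L\<close> of the choice of \<open>S\<close>,
  the centres and the witnesses.\<close>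
definition blocking :: "nat \<Rightarrow> nat \<Rightarrow> real \<Rightarrow> real \<Rightarrow> nat set ugraph \<Rightarrow> bool" where
  "blocking n k B \<delta> X \<longleftrightarrow>
     (\<forall>S r x b. S \<subseteq> {1..n} \<and> B * log 2 n \<le> real (card S) ^ (k - 1) \<and> r \<le> card S \<and>
        (\<forall>j<r. x j \<in> S \<and> b j \<in> nsets S k \<and> x j \<notin> b j)
      \<longrightarrow> \<delta> * real (card S) ^ k < real (card (witness_blocked k S r x b X)))"

lemma card_fibre_gt2_le:
  assumes "finite S" "\<forall>j<r. x j \<in> S"
  shows "3 * card {v \<in> S. card {j. j < r \<and> x j = v} > 2} \<le> r"
proof -
  let ?H = "{v \<in> S. card {j. j < r \<and> x j = v} > 2}"
  have "3 * card ?H = (\<Sum>v\<in>?H. 3)" by simp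
  also have "\<dots> \<le> (\<Sum>v\<in>?H. card {j. j < r \<and> x j = v})" by (intro sum_mono) auto
  also have "\<dots> = card (\<Union>v\<in>?H. {j. j < r \<and> x j = v})"
    using assms by (intro card_UN_disjoint[symmetric]) auto
  also have "\<dots> \<le> card {..<r}" by (intro card_mono) auto
  finally show ?thesis by simp
qed

text \<open>There are at most \<open>card S\<close> classes, so at least half of the elements are centres of at most two of them. A
  \<open>k\<close>-set of such elements is blocked by at most \<open>2 * k\<close> edges, hence with probability at least \<open>1 / 4 ^ k\<close>, and
  distinct sets depend on disjoint sets of edges once the witnesses themselves are excluded. Also excluded
  are the sets meeting one of the witnesses that they have to be joined to; since \<open>x j \<notin> b j\<close>, such a set
  contains two prescribed elements, so these are of lower order in number.\<close>
lemma prob_few_witness_blocked_le: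
  fixes k n r :: nat
  defines "\<eta> \<equiv> 1 / (4 * 4 ^ k * (2 * real k) ^ k) :: real"
  assumes k: "k \<ge> 2" and S: "S \<subseteq> {1..n}" and big: "2 * (real k + 1) * (2 * real k) ^ k \<le> card S"
    and r: "r \<le> card S" and xb: "\<forall>j<r. x j \<in> S \<and> b j \<in> nsets S k \<and> x j \<notin> b j"
  shows "measure_pmf.prob (random_kneser_graph n k (1/2))
      {X. real (card (witness_blocked k S r x b X)) \<le> \<eta> / 2 * real (card S) ^ k}
      \<le> exp (- (\<eta> / 2 * real (card S) ^ k))"
proof -
  let ?m = "card S"
  have fS: "finite S" using S finite_subset by auto
  \<comment> \<open>\<open>S'\<close>: elements that are centres of at most two classes; \<open>G\<close>: the sets considered;
    \<open>Q s\<close>: the edges whose presence blocks \<open>s\<close>.\<close>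
  define S' where "S' = {v \<in> S. card {j. j < r \<and> x j = v} \<le> 2}"
  define Q where "Q = (\<lambda>s. {{s, b j} | j. j < r \<and> x j \<in> s})"
  define G where "G = {s \<in> nsets S' k. s \<notin> b ` {..<r} \<and> (\<forall>j<r. x j \<in> s \<longrightarrow> s \<inter> b j = {})}"
  have k1: "(1::real) \<le> (2 * real k) ^ k" using k by (intro one_le_power) auto
  have "real (2 * k + 2) = 2 * (real k + 1) * 1" by simp
  also have "\<dots> \<le> 2 * (real k + 1) * (2 * real k) ^ k" using k1 by (intro mult_left_mono) auto
  also have "\<dots> \<le> real ?m" by (rule big)
  finally have m2k: "2 * k + 2 \<le> ?m" by (simp only: of_nat_le_iff)
  have GS: "G \<subseteq> nsets S k" unfolding G_def S'_def nsets_def by auto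
  have fG: "finite G" by (rule finite_subset[OF GS finite_imp_finite_nsets[OF fS]])
  have S'card: "?m \<le> 2 * card S'"
  proof -
    have "S = S' \<union> {v \<in> S. card {j. j < r \<and> x j = v} > 2}" by (auto simp: S'_def)
    hence "?m \<le> card S' + card {v \<in> S. card {j. j < r \<and> x j = v} > 2}" by (metis card_Un_le)
    thus ?thesis using card_fibre_gt2_le[of S r x] fS xb r by auto
  qed
  have cardG: "(real ?m / (2 * real k)) ^ k \<le> 2 * card G"
  proof -
    \<comment> \<open>\<open>M\<close> contains the sets that meet a relevant witness.\<close>
    define M where "M = (\<Union>j\<in>{..<r}. \<Union>w\<in>b j. {s \<in> nsets S k. {x j, w} \<subseteq> s})"
    have sub: "nsets S' k \<subseteq> G \<union> (b ` {..<r} \<union> M)"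
      unfolding G_def M_def S'_def using xb by (fastforce simp: nsets_def)
    have finM: "finite M" unfolding M_def using xb fS
      by (auto simp: nsets_def intro!: finite_imp_finite_nsets[unfolded nsets_def])
    have "card M \<le> (\<Sum>j<r. card (\<Union>w\<in>b j. {s \<in> nsets S k. {x j, w} \<subseteq> s}))"
      unfolding M_def by (intro card_UN_le) auto
    also have "\<dots> \<le> (\<Sum>j<r. k * ?m ^ (k - 2))"
    proof (intro sum_mono)
      fix j assume "j \<in> {..<r}"
      hence j: "x j \<in> S" "b j \<subseteq> S" "finite (b j)" "card (b j) = k" "x j \<notin> b j" using xb by (auto simp: nsets_def)
      have "card (\<Union>w\<in>b j. {s \<in> nsets S k. {x j, w} \<subseteq> s}) \<le> (\<Sum>w\<in>b j. card {s \<in> nsets S k. {x j, w} \<subseteq> s})"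
        using j by (intro card_UN_le) auto
      also have "\<dots> \<le> (\<Sum>w\<in>b j. ?m ^ (k - 2))"
      proof (intro sum_mono)
        fix w assume "w \<in> b j"
        hence "x j \<noteq> w" "{x j, w} \<subseteq> S" using j by auto
        thus "card {s \<in> nsets S k. {x j, w} \<subseteq> s} \<le> ?m ^ (k - 2)"
          using card_nsets_superset_le[of S "{x j, w}" k] fS k by (simp add: numeral_2_eq_2)
      qed
      finally show "card (\<Union>w\<in>b j. {s \<in> nsets S k. {x j, w} \<subseteq> s}) \<le> k * ?m ^ (k - 2)" using j by simp
    qed
    also have "\<dots> \<le> ?m * (k * ?m ^ (k - 2))" using r by simp
    also have "\<dots> = k * ?m ^ (k - 1)"
    proof -
      have "k - 1 = Suc (k - 2)" using k by simp
      thus ?thesis by simp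
    qed
    finally have cM: "card M \<le> k * ?m ^ (k - 1)" .
    have "card (b ` {..<r}) \<le> ?m" using r card_image_le[of "{..<r}" b] by simp
    also have "\<dots> \<le> ?m ^ (k - 1)" using k m2k self_le_power[of ?m "k - 1"] by simp
    finally have cb: "card (b ` {..<r}) \<le> ?m ^ (k - 1)" .
    have "card (nsets S' k) \<le> card (G \<union> (b ` {..<r} \<union> M))" using fG finM by (intro card_mono sub) auto
    also have "\<dots> \<le> card G + (card (b ` {..<r}) + card M)"
      by (meson add_left_mono card_Un_le le_trans)
    also have "\<dots> \<le> card G + (k + 1) * ?m ^ (k - 1)" using cM cb by (simp add: algebra_simps)
    finally have "real (card (nsets S' k)) \<le> real (card G + (k + 1) * ?m ^ (k - 1))" by (simp only: of_nat_le_iff)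
    hence up: "real (card (nsets S' k)) \<le> real (card G) + (real k + 1) * real ?m ^ (k - 1)"
      by (simp add: distrib_right)
    have "(real ?m / (2 * real k)) ^ k \<le> (real (card S') / real k) ^ k"
      using S'card k by (intro power_mono) (auto simp: field_simps)
    also have "\<dots> \<le> real (card S' choose k)" using S'card m2k by (intro binomial_ge_n_over_k_pow_k) auto
    finally have lo: "(real ?m / (2 * real k)) ^ k \<le> real (card (nsets S' k))" by simp
    have "(real k + 1) * real ?m ^ (k - 1) \<le> (real ?m / (2 * real k)) ^ k / 2"
    proof -
      have "(2 * (real k + 1) * (2 * real k) ^ k) * real ?m ^ (k - 1) \<le> real ?m * real ?m ^ (k - 1)"
        using big by (intro mult_right_mono) auto
      also have "\<dots> = real ?m ^ k" using k by (simp flip: power_Suc)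
      finally show ?thesis using k by (simp add: power_divide field_simps)
    qed
    thus ?thesis using lo up by linarith
  qed
  have QE: "Q s \<subseteq> edges (kneser_graph n k)" if "s \<in> G" for s
  proof -
    have "nsets S k \<subseteq> nsets {1..n} k" using S by (rule nsets_mono)
    thus ?thesis using that GS xb unfolding Q_def G_def
      by (auto simp only: in_edges_kneser_iff mem_Collect_eq) blast+
  qed
  have disj: "disjoint_family_on Q G"
  proof -
    have False if "s \<in> G" "s' \<in> G" "s \<noteq> s'" "j < r" "j' < r" "{s, b j} = {s', b j'}" for s s' j j'
      using that by (auto simp: G_def doubleton_eq_iff)
    thus ?thesis unfolding disjoint_family_on_def Q_def
      by (intro ballI impI equals0I) (elim IntE CollectE exE conjE, metis)
  qed
  have Qcard: "card (Q s) \<le> 2 * k" if "s \<in> G" for s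
  proof -
    have s: "s \<subseteq> S'" "finite s" "card s = k" using that by (auto simp: G_def nsets_def)
    have "Q s \<subseteq> (\<Union>v\<in>s. (\<lambda>j. {s, b j}) ` {j. j < r \<and> x j = v})" by (auto simp: Q_def)
    hence "card (Q s) \<le> card (\<Union>v\<in>s. (\<lambda>j. {s, b j}) ` {j. j < r \<and> x j = v})"
      using s by (intro card_mono) auto
    also have "\<dots> \<le> (\<Sum>v\<in>s. card ((\<lambda>j. {s, b j}) ` {j. j < r \<and> x j = v}))" using s by (intro card_UN_le) auto
    also have "\<dots> \<le> (\<Sum>v\<in>s. 2)"
    proof (intro sum_mono)
      fix v assume "v \<in> s"
      hence "card {j. j < r \<and> x j = v} \<le> 2" using s by (auto simp: S'_def)
      thus "card ((\<lambda>j. {s, b j}) ` {j. j < r \<and> x j = v}) \<le> 2"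
        using card_image_le[of "{j. j < r \<and> x j = v}" "\<lambda>j. {s, b j}"] by simp
    qed
    finally show ?thesis using s by simp
  qed
  let ?a = "\<eta> / 2 * real ?m ^ k"
  have "measure_pmf.prob (random_kneser_graph n k (1/2))
      {X. real (card (witness_blocked k S r x b X)) \<le> ?a}
    \<le> measure_pmf.prob (random_kneser_graph n k (1/2)) {X. real (card {s \<in> G. Q s \<subseteq> edges X}) \<le> ?a}"
  proof (intro measure_pmf.finite_measure_mono subsetI CollectI)
    fix X assume "X \<in> {X. real (card (witness_blocked k S r x b X)) \<le> ?a}"
    moreover have "card {s \<in> G. Q s \<subseteq> edges X} \<le> card (witness_blocked k S r x b X)"
    proof (rule card_mono)
      show "finite (witness_blocked k S r x b X)"
        unfolding witness_blocked_def using fS by (simp add: finite_imp_finite_nsets)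
      show "{s \<in> G. Q s \<subseteq> edges X} \<subseteq> witness_blocked k S r x b X"
        using GS unfolding witness_blocked_def Q_def by blast
    qed
    ultimately show "real (card {s \<in> G. Q s \<subseteq> edges X}) \<le> ?a" by simp
  qed auto
  also have "\<dots> \<le> 2 powr ?a * (\<Prod>s\<in>G. 1 - (1/2) * (1/2) ^ card (Q s))"
    unfolding random_kneser_graph_def
    by (rule prob_few_blocks_present[OF finite_edges_kneser_graph fG QE disj])
  also have "\<dots> \<le> exp ?a * (\<Prod>s\<in>G. exp (- (1 / (2 * 4 ^ k))))"
  proof (intro mult_mono prod_mono conjI prod_nonneg)
    have "?a \<ge> 0" by (simp add: \<eta>_def)
    have "2 powr ?a = exp (?a * ln 2)" by (simp add: powr_def)
    also have "\<dots> \<le> exp ?a" using \<open>?a \<ge> 0\<close> ln_2_less_1 by (simp add: mult_left_le)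
    finally show "2 powr ?a \<le> exp ?a" .
    fix s assume "s \<in> G"
    have half: "(1/2::real) ^ card (Q s) \<le> 1" by (simp add: power_le_one)
    show "0 \<le> 1 - (1/2) * (1/2::real) ^ card (Q s)" "0 \<le> 1 - (1/2) * (1/2::real) ^ card (Q s)" using half by linarith+
    have "(1/2::real) ^ (2 * k) \<le> (1/2) ^ card (Q s)" using Qcard[OF \<open>s \<in> G\<close>] by (intro power_decreasing) auto
    hence "1 - (1/2) * (1/2::real) ^ card (Q s) \<le> 1 + (- (1 / (2 * 4 ^ k)))"
      by (simp add: power_mult power_one_over power2_eq_square)
    also have "\<dots> \<le> exp (- (1 / (2 * 4 ^ k)))" by (rule exp_ge_add_one_self)
    finally show "1 - (1/2) * (1/2::real) ^ card (Q s) \<le> exp (- (1 / (2 * 4 ^ k)))" .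
  qed auto
  also have "\<dots> = exp (?a - real (card G) / (2 * 4 ^ k))"
    unfolding prod_constant exp_of_nat_mult[symmetric] exp_add[symmetric]
    by (intro arg_cong[where f=exp]) simp
  also have "\<dots> \<le> exp (- ?a)"
  proof -
    have "2 * ?a = (real ?m / (2 * real k)) ^ k / (4 * 4 ^ k)"
      by (simp add: \<eta>_def power_divide)
    also have "\<dots> \<le> (2 * card G) / (4 * 4 ^ k)" using cardG by (intro divide_right_mono) auto
    also have "\<dots> = real (card G) / (2 * 4 ^ k)" by simp
    finally show ?thesis by simp
  qed
  finally show ?thesis .
qed

text \<open>There are at most \<open>n ^ ((k + 2) * m)\<close> choices with \<open>card S = m\<close>, and the constant \<open>2 * (k + 6) / \<eta>\<close> makes the
  failure probability of each of them at most \<open>1 / n ^ ((k + 6) * m)\<close>.\<close>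
lemma asymp_almost_surely_blocking:
  fixes k :: nat
  defines "\<eta> \<equiv> 1 / (4 * 4 ^ k * (2 * real k) ^ k) :: real"
  assumes k: "k \<ge> 2"
  shows "asymp_almost_surely (\<lambda>n. random_kneser_graph n k (1/2))
           (\<lambda>n X. blocking n k (2 * (real k + 6) / \<eta>) (\<eta> / 2) X)"
proof (rule asymp_almost_surelyI)
  let ?B = "2 * (real k + 6) / \<eta>"
  have \<eta>: "\<eta> > 0" using k by (simp add: \<eta>_def)
  show "(\<lambda>n::nat. 2 / real n) \<longlonglongrightarrow> 0" by real_asymp
  have "?B > 0" using \<eta> by simp
  moreover have "\<forall>\<^sub>F n::nat in sequentially. a \<le> c * log 2 n" if "c > 0" for a c :: real
    using that by real_asymp
  ultimately have "\<forall>\<^sub>F n::nat in sequentially. (2 * (real k + 1) * (2 * real k) ^ k) ^ (k - 1) \<le> ?B * log 2 n"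
    by blast
  thus "\<forall>\<^sub>F n in sequentially. measure_pmf.prob (random_kneser_graph n k (1/2))
      {X. \<not> blocking n k ?B (\<eta> / 2) X} \<le> 2 / real n"
    using eventually_ge_at_top[of 2]
  proof eventually_elim
    case (elim n)
    let ?M = "random_kneser_graph n k (1/2)"
    let ?J = "\<lambda>(m, r). SIGMA S:nsets {1..n} m. ({..<r} \<rightarrow>\<^sub>E S) \<times> ({..<r} \<rightarrow>\<^sub>E nsets S k)"
    let ?good = "\<lambda>(S, x, b) r. ?B * log 2 n \<le> real (card S) ^ (k - 1) \<and> r \<le> card S \<and>
        (\<forall>j<r. x j \<in> S \<and> b j \<in> nsets S k \<and> x j \<notin> b j)"
    let ?bad = "\<lambda>(S, x, b) r X. real (card (witness_blocked k S r x b X)) \<le> \<eta> / 2 * real (card S) ^ k"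
    let ?O = "{1..n} \<times> {..n}"
    have "{X. \<not> blocking n k ?B (\<eta> / 2) X} \<subseteq> {X. \<exists>p\<in>?O. \<exists>i\<in>?J p. ?good i (snd p) \<and> ?bad i (snd p) X}"
    proof
      fix X assume "X \<in> {X. \<not> blocking n k ?B (\<eta> / 2) X}"
      then obtain S r x b where S: "S \<subseteq> {1..n}" "?B * log 2 n \<le> real (card S) ^ (k - 1)" "r \<le> card S"
        "\<forall>j<r. x j \<in> S \<and> b j \<in> nsets S k \<and> x j \<notin> b j"
        "real (card (witness_blocked k S r x b X)) \<le> \<eta> / 2 * real (card S) ^ k"
        unfolding blocking_def mem_Collect_eq not_all not_imp not_less by blast
      have fS: "finite S" "card S \<le> n" using S(1) finite_subset card_mono[of "{1..n}" S] by auto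
      have "0 < ?B * log 2 n" using elim \<eta> by simp
      hence "real (card S) ^ (k - 1) \<noteq> 0" using S(2) by linarith
      hence "card S \<noteq> 0" using k by (auto simp: zero_power)
      hence "1 \<le> card S" by linarith
      hence "(card S, r) \<in> ?O" using S fS by auto
      let ?x = "restrict x {..<r}" and ?b = "restrict b {..<r}"
      have wb: "witness_blocked k S r ?x ?b X = witness_blocked k S r x b X"
        unfolding witness_blocked_def by auto
      have "(S, ?x, ?b) \<in> ?J (card S, r)"
        using S(1,4) fS by (auto simp: nsets_def)
      moreover have "?good (S, ?x, ?b) r \<and> ?bad (S, ?x, ?b) r X" using S wb by auto
      ultimately show "X \<in> {X. \<exists>p\<in>?O. \<exists>i\<in>?J p. ?good i (snd p) \<and> ?bad i (snd p) X}"
        using \<open>(card S, r) \<in> ?O\<close> by (intro CollectI bexI[of _ "(card S, r)"] bexI[of _ "(S, ?x, ?b)"]) auto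
    qed
    hence "measure_pmf.prob ?M {X. \<not> blocking n k ?B (\<eta> / 2) X}
        \<le> measure_pmf.prob ?M {X. \<exists>p\<in>?O. \<exists>i\<in>?J p. ?good i (snd p) \<and> ?bad i (snd p) X}"
      by (intro measure_pmf.finite_measure_mono) auto
    also have "\<dots> \<le> real (card ?O) * (1 / real n ^ 4)"
    proof (rule prob_union_bound)
      fix p assume "p \<in> ?O"
      then obtain m r where p: "p = (m, r)" "1 \<le> m" "m \<le> n" by auto
      show "measure_pmf.prob ?M {X. \<exists>i\<in>?J p. ?good i (snd p) \<and> ?bad i (snd p) X} \<le> 1 / real n ^ 4"
      proof (cases "r \<le> m")
        case False
        hence "{X. \<exists>i\<in>?J p. ?good i (snd p) \<and> ?bad i (snd p) X} = {}" by (auto simp: p nsets_def)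
        thus ?thesis by (simp only: measure_empty) simp
      next
        case True
        have finS: "finite ({..<r} \<rightarrow>\<^sub>E S)" "finite ({..<r} \<rightarrow>\<^sub>E nsets S k)" if "S \<in> nsets {1..n} m" for S
          using that by (auto simp: nsets_def intro!: finite_imp_finite_nsets[unfolded nsets_def] finite_PiE)
        have finJ: "finite (?J p)" unfolding p prod.case
          by (intro finite_SigmaI finite_cartesian_product finS finite_imp_finite_nsets finite_atLeastAtMost)
        have "card (?J p) = (\<Sum>S\<in>nsets {1..n} m. card ({..<r} \<rightarrow>\<^sub>E S) * card ({..<r} \<rightarrow>\<^sub>E nsets S k))"
          unfolding p prod.case using finS
          by (subst card_SigmaI) (auto simp: card_cartesian_product finite_imp_finite_nsets)
        also have "\<dots> \<le> (\<Sum>S\<in>nsets {1..n} m. n ^ m * n ^ (k * m))"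
        proof (intro sum_mono mult_le_mono)
          fix S assume "S \<in> nsets {1..n} m"
          hence S: "card S = m" by (auto simp: nsets_def)
          have "m ^ r \<le> n ^ r" using p by (intro power_mono) auto
          also have "\<dots> \<le> n ^ m" using True elim by (intro power_increasing) auto
          finally show "card ({..<r} \<rightarrow>\<^sub>E S) \<le> n ^ m" using S by (simp add: card_PiE)
          have "card (nsets S k) \<le> n ^ k" using card_nsets_le[of S k] S p power_mono[of m n k] by simp
          hence "card (nsets S k) ^ r \<le> (n ^ k) ^ r" by (intro power_mono) auto
          also have "\<dots> \<le> (n ^ k) ^ m" using True elim by (intro power_increasing) auto
          finally show "card ({..<r} \<rightarrow>\<^sub>E nsets S k) \<le> n ^ (k * m)" by (simp add: card_PiE power_mult)
        qed
        also have "\<dots> \<le> n ^ m * (n ^ m * n ^ (k * m))" using card_nsets_le[of "{1..n}" m] by simp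
        also have "\<dots> = n ^ ((k + 2) * m)" by (simp add: distrib_right power_add mult_2)
        finally have cardJ: "real (card (?J p)) \<le> real n ^ ((k + 2) * m)" by (simp only: of_nat_le_iff flip: of_nat_power)
        have "measure_pmf.prob ?M {X. \<exists>i\<in>?J p. ?good i (snd p) \<and> ?bad i (snd p) X}
            \<le> real (card (?J p)) * (1 / real n ^ ((k + 6) * m))"
        proof (rule prob_union_bound[OF finJ])
          fix i assume "i \<in> ?J p"
          then obtain S x b where i: "i = (S, x, b)" "S \<in> nsets {1..n} m" unfolding p by auto
          have S: "S \<subseteq> {1..n}" "card S = m" using i by (auto simp: nsets_def)
          show "measure_pmf.prob ?M {X. ?good i (snd p) \<and> ?bad i (snd p) X} \<le> 1 / real n ^ ((k + 6) * m)"
          proof (cases "?good i r")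
            case False
            hence "{X. ?good i (snd p) \<and> ?bad i (snd p) X} = {}" by (auto simp: p)
            thus ?thesis by (simp only: measure_empty) simp
          next
            case good: True
            hence B: "?B * log 2 n \<le> real m ^ (k - 1)" using S by (auto simp: i)
            have "(2 * (real k + 1) * (2 * real k) ^ k) ^ (k - 1) \<le> real m ^ (k - 1)" using elim B by linarith
            hence big: "2 * (real k + 1) * (2 * real k) ^ k \<le> real (card S)"
              using k S(2) by (subst (asm) power_mono_iff) auto
            have "measure_pmf.prob ?M {X. ?good i (snd p) \<and> ?bad i (snd p) X}
                \<le> measure_pmf.prob ?M {X. real (card (witness_blocked k S r x b X)) \<le> \<eta> / 2 * real (card S) ^ k}"
              by (intro measure_pmf.finite_measure_mono) (auto simp: i p)
            also have "\<dots> \<le> exp (- (\<eta> / 2 * real (card S) ^ k))"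
              using good unfolding \<eta>_def
              by (intro prob_few_witness_blocked_le[OF k S(1) big]) (auto simp: i)
            also have "\<dots> \<le> exp (- ((real k + 6) * real m * log 2 n))"
            proof -
              have "(real k + 6) * real m * log 2 n = \<eta> / 2 * (real m * (?B * log 2 n))"
                using \<eta> by (simp add: field_simps)
              also have "\<dots> \<le> \<eta> / 2 * (real m * real m ^ (k - 1))"
                using B \<eta> by (intro mult_left_mono) auto
              also have "\<dots> = \<eta> / 2 * real (card S) ^ k" using k S(2) by (simp flip: power_Suc)
              finally show ?thesis by simp
            qed
            also have "\<dots> \<le> 2 powr (- ((real k + 6) * real m * log 2 n))"
            proof -
              have "0 \<le> (real k + 6) * real m * log 2 n" using elim by simp
              hence "(real k + 6) * real m * log 2 n * ln 2 \<le> (real k + 6) * real m * log 2 n"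
                using ln_2_less_1 by (intro mult_left_le) auto
              thus ?thesis by (simp add: powr_def)
            qed
            also have "\<dots> = 1 / (2 powr log 2 n) powr real ((k + 6) * m)"
              unfolding powr_powr by (simp add: powr_minus divide_simps mult_ac)
            also have "\<dots> = 1 / real n ^ ((k + 6) * m)"
              using elim powr_realpow[of "real n" "(k + 6) * m"] by simp
            finally show ?thesis .
          qed
        qed
        also have "\<dots> \<le> real n ^ ((k + 2) * m) * (1 / real n ^ ((k + 6) * m))" by (intro mult_right_mono cardJ) auto
        also have "\<dots> = 1 / real n ^ (4 * m)"
        proof -
          have "real n ^ ((k + 6) * m) = real n ^ ((k + 2) * m) * real n ^ (4 * m)"
            by (simp add: distrib_right add_ac flip: power_add)
          thus ?thesis using elim by simp
        qed
        also have "\<dots> \<le> 1 / real n ^ 4" using elim p by (intro divide_left_mono power_increasing) auto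
        finally show ?thesis .
      qed
    qed auto
    also have "\<dots> \<le> 2 / real n"
    proof -
      have "real (card ?O) = real n * (real n + 1)" by (simp add: card_cartesian_product algebra_simps)
      also have "\<dots> \<le> real n * (2 * real n)" using elim by (intro mult_left_mono) auto
      finally have "real (card ?O) * (1 / real n ^ 4) \<le> real n * (2 * real n) * (1 / real n ^ 4)"
        by (intro mult_right_mono) auto
      also have "\<dots> = 2 / real n ^ 2" using elim by (simp add: power2_eq_square power4_eq_xxxx)
      also have "\<dots> \<le> 2 / real n" using elim by (intro divide_left_mono) (auto simp: power2_eq_square)
      finally show ?thesis .
    qed
    finally show ?case .
  qed
qed

section \<open>Lower bound: peeling stars off a colouring\<close>

text \<open>Let \<open>z\<close> be the largest degree in \<open>F\<close>. The set \<open>b\<close> meets at most \<open>k * z\<close> members of \<open>F\<close>, which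
  settles the case of small \<open>z\<close>; and as \<open>b\<close> misses \<open>x\<close>, it meets only lower order many of the \<open>z\<close> members through
  \<open>x\<close>, which settles the case of large \<open>z\<close>.\<close>
lemma card_le_disjoint_degree:
  assumes S: "finite S" "F \<subseteq> nsets S k" and k: "k \<ge> 2"
    and max: "\<And>y. y \<in> S \<Longrightarrow> card {s \<in> F. y \<in> s} \<le> card {s \<in> F. x \<in> s}"
    and b: "b \<in> F" "x \<in> S" "x \<notin> b" and large: "2 * k ^ 2 * card S ^ (k - 2) \<le> card F"
  shows "card F \<le> 4 * k * card {s \<in> F. b \<inter> s = {}}"
proof -
  let ?z = "card {s \<in> F. x \<in> s}" and ?d = "card {s \<in> F. b \<inter> s = {}}" and ?p = "card S ^ (k - 2)"
  have finF: "finite F" using S finite_subset finite_imp_finite_nsets by blast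
  have bS: "b \<subseteq> S" "finite b" "card b = k" using b S by (auto simp: nsets_def)
  have "card F \<le> card ({s \<in> F. b \<inter> s = {}} \<union> (\<Union>w\<in>b. {s \<in> F. w \<in> s}))"
    using finF bS by (intro card_mono) auto
  also have "\<dots> \<le> ?d + card (\<Union>w\<in>b. {s \<in> F. w \<in> s})" by (rule card_Un_le)
  also have "card (\<Union>w\<in>b. {s \<in> F. w \<in> s}) \<le> (\<Sum>w\<in>b. card {s \<in> F. w \<in> s})" using bS by (intro card_UN_le)
  also have "\<dots> \<le> (\<Sum>w\<in>b. ?z)" using bS max by (intro sum_mono) auto
  finally have 1: "card F \<le> ?d + k * ?z" using bS by simp
  have "?z \<le> card ({s \<in> F. b \<inter> s = {}} \<union> (\<Union>w\<in>b. {s \<in> nsets S k. {x, w} \<subseteq> s}))"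
    using finF bS S by (intro card_mono) (auto simp: finite_imp_finite_nsets)
  also have "\<dots> \<le> ?d + card (\<Union>w\<in>b. {s \<in> nsets S k. {x, w} \<subseteq> s})" by (rule card_Un_le)
  also have "card (\<Union>w\<in>b. {s \<in> nsets S k. {x, w} \<subseteq> s}) \<le> (\<Sum>w\<in>b. card {s \<in> nsets S k. {x, w} \<subseteq> s})"
    using bS by (intro card_UN_le)
  also have "\<dots> \<le> (\<Sum>w\<in>b. ?p)"
  proof (intro sum_mono)
    fix w assume "w \<in> b"
    hence "x \<noteq> w" "{x, w} \<subseteq> S" using b bS by auto
    thus "card {s \<in> nsets S k. {x, w} \<subseteq> s} \<le> ?p"
      using card_nsets_superset_le[of S "{x, w}" k] S k by (simp add: numeral_2_eq_2)
  qed
  finally have 2: "?z \<le> ?d + k * ?p" using bS by simp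
  have "2 * card F \<le> 2 * (?d + k * (?d + k * ?p))" using 1 2 by (meson add_left_mono mult_le_mono2 order_trans)
  also have "\<dots> = 2 * (k + 1) * ?d + 2 * k ^ 2 * ?p" by (simp add: algebra_simps power2_eq_square)
  also have "\<dots> \<le> 2 * (k + 1) * ?d + card F" using large by simp
  finally have "card F \<le> (2 * k + 2) * ?d" by simp
  also have "\<dots> \<le> 4 * k * ?d" using k by (intro mult_right_mono) auto
  finally show ?thesis .
qed

text \<open>Double counting; a pair \<open>{a, b}\<close> is counted once as \<open>(a, b)\<close> and once as \<open>(b, a)\<close>.\<close>
lemma sum_disjoint_degree_le:
  assumes "finite D"
  shows "(\<Sum>b\<in>D. card {s \<in> D. c s = c b \<and> b \<inter> s = {}}) \<le> 2 * card (mono_pairs D c)"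
proof -
  let ?P = "SIGMA b:D. {s \<in> D. c s = c b \<and> b \<inter> s = {}}"
  have "(\<Sum>b\<in>D. card {s \<in> D. c s = c b \<and> b \<inter> s = {}}) = card ?P"
    using assms by (subst card_SigmaI) auto
  also have "?P = (\<Union>e\<in>mono_pairs D c. {p \<in> ?P. {fst p, snd p} = e})"
    unfolding mono_pairs_def by fastforce
  also have "card \<dots> \<le> (\<Sum>e\<in>mono_pairs D c. card {p \<in> ?P. {fst p, snd p} = e})"
  proof (rule card_UN_le)
    show "finite (mono_pairs D c)"
      by (rule finite_subset[of _ "Pow D"]) (use assms in \<open>auto simp: mono_pairs_def\<close>)
  qed
  also have "\<dots> \<le> (\<Sum>e\<in>mono_pairs D c. 2)"
  proof (intro sum_mono)
    fix e assume "e \<in> mono_pairs D c"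
    then obtain a b where e: "e = {a, b}" by (auto simp: mono_pairs_def)
    have "{p \<in> ?P. {fst p, snd p} = e} \<subseteq> {(a, b), (b, a)}" by (auto simp: e doubleton_eq_iff)
    hence "card {p \<in> ?P. {fst p, snd p} = e} \<le> card {(a, b), (b, a)}" by (intro card_mono) auto
    also have "\<dots> \<le> 2" by (cases "a = b") auto
    finally show "card {p \<in> ?P. {fst p, snd p} = e} \<le> 2" .
  qed
  finally show ?thesis by simp
qed

definition residual :: "'a set set \<Rightarrow> ('a set \<Rightarrow> nat) \<Rightarrow> nat \<Rightarrow> 'a \<Rightarrow> 'a set set" where
  "residual A c j x = {s \<in> A. c s = j \<and> x \<notin> s}"

text \<open>A class all of whose residuals have size at least \<open>\<theta>\<close>, the threshold in the last assumption, contains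
  at least \<open>\<theta> / (8 * k)\<close> disjoint pairs per member, unless it has fewer than \<open>2 * k ^ 2 * m ^ (k - 2)\<close> members and
  is negligible. Comparing with \<open>conflict_free_sparse\<close>, the part \<open>C * log 2 m\<close> of \<open>\<theta>\<close>
  outweighs the term \<open>card D * log 2 m\<close>, and the part \<open>C * L / m ^ (k - 1)\<close> leaves room for at most
  \<open>\<delta> / 2 * m ^ k\<close> members, because the remaining term is \<open>4 * m * L\<close>.\<close>
lemma card_spread_classes_le:
  fixes \<delta> C :: real
  assumes k: "k \<ge> 2" and n: "n \<ge> 2" and sp: "conflict_free_sparse n k X"
    and S: "S \<subseteq> {1..n}" "k \<le> card S" and A: "A \<subseteq> nsets S k"
    and c: "\<And>s. s \<in> A \<Longrightarrow> c s \<in> K" "finite K" "card K \<le> card S"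
    and proper: "\<And>u v. u \<in> A \<Longrightarrow> v \<in> A \<Longrightarrow> {u, v} \<in> edges X \<Longrightarrow> c u \<noteq> c v"
    and \<delta>: "\<delta> > 0" and C: "8 * real k * (real k + 1) \<le> C" "64 * real k / \<delta> \<le> C"
    and large: "4 * real k ^ 2 / \<delta> \<le> card S"
    and J: "\<And>j x. j \<in> J \<Longrightarrow> x \<in> S \<Longrightarrow>
        C * (log 2 n / real (card S) ^ (k - 1) + log 2 (card S)) \<le> real (card (residual A c j x))"
  shows "real (card {s \<in> A. c s \<in> J}) \<le> \<delta> * real (card S) ^ k"
proof -
  let ?m = "card S" and ?\<theta> = "C * (log 2 n / real (card S) ^ (k - 1) + log 2 (card S))"
  let ?F = "\<lambda>j. {s \<in> A. c s = j}"
  have fS: "finite S" using S finite_subset by auto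
  have m: "?m \<ge> 2" "S \<noteq> {}" using S k by auto
  have finA: "finite A" using A fS finite_subset finite_imp_finite_nsets by blast
  have mk: "real ?m * real ?m ^ (k - 1) = real ?m ^ k" using k by (simp flip: power_Suc)
  \<comment> \<open>\<open>J'\<close>: the non-negligible classes; \<open>D\<close>: their members.\<close>
  define J' where "J' = {j \<in> J. 2 * k ^ 2 * ?m ^ (k - 2) \<le> card (?F j)}"
  define D where "D = {s \<in> A. c s \<in> J'}"
  have finD: "finite D" using finA by (simp add: D_def)
  have DA: "D \<subseteq> A" by (auto simp: D_def)
  have small: "real (card {s \<in> A. c s \<in> J - J'}) \<le> \<delta> / 2 * real ?m ^ k"
  proof -
    have "{s \<in> A. c s \<in> J - J'} = (\<Union>j\<in>K \<inter> (J - J'). ?F j)" using c by auto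
    hence "card {s \<in> A. c s \<in> J - J'} \<le> (\<Sum>j\<in>K \<inter> (J - J'). card (?F j))"
      using c by (simp add: card_UN_le)
    also have "\<dots> \<le> (\<Sum>j\<in>K \<inter> (J - J'). 2 * k ^ 2 * ?m ^ (k - 2))" by (intro sum_mono) (auto simp: J'_def)
    also have "\<dots> \<le> ?m * (2 * k ^ 2 * ?m ^ (k - 2))"
    proof -
      have "card (K \<inter> (J - J')) \<le> ?m" using c card_mono[of K "K \<inter> (J - J')"] by (meson Int_lower1 order_trans)
      thus ?thesis unfolding sum_constant of_nat_id by (rule mult_le_mono1)
    qed
    also have "\<dots> = 2 * k ^ 2 * ?m ^ (k - 1)"
    proof -
      have "k - 1 = Suc (k - 2)" using k by simp
      thus ?thesis by simp
    qed
    finally have "real (card {s \<in> A. c s \<in> J - J'}) \<le> real (2 * k ^ 2 * ?m ^ (k - 1))" by (simp only: of_nat_le_iff)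
    also have "\<dots> = (2 * k ^ 2) * real ?m ^ (k - 1)" by simp
    also have "\<dots> \<le> (\<delta> / 2 * real ?m) * real ?m ^ (k - 1)"
      using large \<delta> by (intro mult_right_mono) (auto simp: field_simps)
    finally show ?thesis using mk by (simp add: mult_ac)
  qed
  have main: "real (card D) \<le> \<delta> / 2 * real ?m ^ k"
  proof -
    obtain h where h: "inj_on h K" "h ` K \<subseteq> {..<?m}"
      using c(2,3) by (metis card_le_inj card_lessThan finite_lessThan)
    have mono: "mono_pairs D c = mono_pairs D (h \<circ> c)"
      using c(1) DA h(1) by (intro mono_pairs_cong) (auto simp: inj_on_eq_iff subset_iff)
    have "mono_pairs D c \<inter> edges X = {}"
      using proper DA by (auto simp: mono_pairs_def)
    hence "mono_pairs D (h \<circ> c) \<inter> edges X = {}" unfolding mono .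
    moreover have "h \<circ> c \<in> D \<rightarrow> {..<?m}" using h c(1) DA by (auto simp: image_subset_iff subset_iff)
    moreover have "D \<subseteq> nsets S k" using A DA by blast
    ultimately have up: "real (card (mono_pairs D c)) < 4 * ?m * log 2 n + (k + 1) * card D * log 2 ?m"
      using sp S unfolding conflict_free_sparse_def mono by blast
    have "\<forall>j. \<exists>x. x \<in> S \<and> (\<forall>y. y \<in> S \<longrightarrow> card {s \<in> ?F j. y \<in> s} \<le> card {s \<in> ?F j. x \<in> s})"
      using m(2) finA
      by (intro allI Lattices_Big.ex_has_greatest_nat[of _ "SOME x. x \<in> S" _ "Suc (card A)"])
        (auto intro!: card_mono simp: less_Suc_eq_le some_in_eq)
    from choice[OF this] obtain x
      where x: "\<And>j. x j \<in> S" "\<And>j y. y \<in> S \<Longrightarrow> card {s \<in> ?F j. y \<in> s} \<le> card {s \<in> ?F j. x j \<in> s}"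
      by blast
    have deg: "card (?F (c b)) \<le> 4 * k * card {s \<in> D. c s = c b \<and> b \<inter> s = {}}" if "b \<in> D" "x (c b) \<notin> b" for b
    proof -
      have "card (?F (c b)) \<le> 4 * k * card {s \<in> ?F (c b). b \<inter> s = {}}"
        using that DA A x by (intro card_le_disjoint_degree[of S _ k "x (c b)" b] fS k) (auto simp: D_def J'_def)
      also have "{s \<in> ?F (c b). b \<inter> s = {}} = {s \<in> D. c s = c b \<and> b \<inter> s = {}}"
        using that by (auto simp: D_def)
      finally show ?thesis .
    qed
    \<comment> \<open>Sum over the members of \<open>D\<close> the residual size of their class, and exchange the order of summation:
      each residual member \<open>b'\<close> is counted once for every member of its class.\<close>
    have "?\<theta> * real (card D) = (\<Sum>b\<in>D. ?\<theta>)" by simp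
    also have "\<dots> \<le> (\<Sum>b\<in>D. real (card (residual A c (c b) (x (c b)))))"
      using x(1) by (intro sum_mono J) (auto simp: D_def J'_def)
    also have "\<dots> = real (\<Sum>b\<in>D. card {b' \<in> D. c b' = c b \<and> x (c b) \<notin> b'})"
    proof -
      have "residual A c (c b) (x (c b)) = {b' \<in> D. c b' = c b \<and> x (c b) \<notin> b'}" if "b \<in> D" for b
        using that by (auto simp: D_def residual_def)
      thus ?thesis by simp
    qed
    also have "(\<Sum>b\<in>D. card {b' \<in> D. c b' = c b \<and> x (c b) \<notin> b'})
        = card (SIGMA b:D. {b' \<in> D. c b' = c b \<and> x (c b) \<notin> b'})"
      using finD by (subst card_SigmaI) auto
    also have "\<dots> = card (SIGMA b':{b' \<in> D. x (c b') \<notin> b'}. {b \<in> D. c b = c b'})"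
      by (rule bij_betw_same_card[of prod.swap], rule bij_betwI[of _ _ _ prod.swap]) auto
    also have "\<dots> = (\<Sum>b'\<in>{b' \<in> D. x (c b') \<notin> b'}. card {b \<in> D. c b = c b'})"
      using finD by (subst card_SigmaI) auto
    also have "\<dots> \<le> (\<Sum>b'\<in>{b' \<in> D. x (c b') \<notin> b'}. 4 * k * card {s \<in> D. c s = c b' \<and> b' \<inter> s = {}})"
    proof (intro sum_mono)
      fix b' assume b': "b' \<in> {b' \<in> D. x (c b') \<notin> b'}"
      have "card {b \<in> D. c b = c b'} \<le> card (?F (c b'))" using finA DA by (intro card_mono) auto
      also have "\<dots> \<le> 4 * k * card {s \<in> D. c s = c b' \<and> b' \<inter> s = {}}" using b' by (intro deg) auto
      finally show "card {b \<in> D. c b = c b'} \<le> 4 * k * card {s \<in> D. c s = c b' \<and> b' \<inter> s = {}}" .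
    qed
    also have "\<dots> \<le> (\<Sum>b'\<in>D. 4 * k * card {s \<in> D. c s = c b' \<and> b' \<inter> s = {}})"
      using finD by (intro sum_mono2) auto
    also have "\<dots> = 4 * k * (\<Sum>b'\<in>D. card {s \<in> D. c s = c b' \<and> b' \<inter> s = {}})" by (simp add: sum_distrib_left)
    also have "\<dots> \<le> 4 * k * (2 * card (mono_pairs D c))" by (intro mult_le_mono2 sum_disjoint_degree_le finD)
    finally have "?\<theta> * real (card D) \<le> 8 * real k * real (card (mono_pairs D c))" by simp
    also have "\<dots> \<le> 8 * real k * (4 * ?m * log 2 n + (k + 1) * card D * log 2 ?m)"
      using up by (intro mult_left_mono) auto
    also have "\<dots> = 32 * real k * real ?m * log 2 n + (8 * real k * (real k + 1)) * (real (card D) * log 2 ?m)"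
      by (simp add: algebra_simps)
    also have "\<dots> \<le> 32 * real k * real ?m * log 2 n + C * (real (card D) * log 2 ?m)"
      using C(1) m by (intro add_left_mono mult_right_mono) auto
    finally have "C * real (card D) * log 2 n / real ?m ^ (k - 1) \<le> 32 * real k * real ?m * log 2 n"
      by (simp add: algebra_simps)
    hence "C * real (card D) * log 2 n \<le> 32 * real k * real ?m * log 2 n * real ?m ^ (k - 1)"
      using m by (simp add: pos_divide_le_eq)
    also have "\<dots> = (32 * real k * (real ?m * real ?m ^ (k - 1))) * log 2 n" by simp
    finally have "(C * real (card D)) * log 2 n \<le> (32 * real k * real ?m ^ k) * log 2 n"
      unfolding mk .
    hence "C * real (card D) \<le> 32 * real k * real ?m ^ k" using n by simp
    moreover have "(64 * real k / \<delta>) * real (card D) \<le> C * real (card D)" using C(2) by (intro mult_right_mono) auto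
    ultimately have "(64 * real k / \<delta>) * real (card D) \<le> 32 * real k * real ?m ^ k" by linarith
    thus ?thesis using \<delta> k by (simp add: field_simps)
  qed
  have "{s \<in> A. c s \<in> J} = D \<union> {s \<in> A. c s \<in> J - J'}" by (auto simp: D_def J'_def)
  hence "card {s \<in> A. c s \<in> J} \<le> card D + card {s \<in> A. c s \<in> J - J'}" by (metis card_Un_le)
  thus ?thesis using small main by linarith
qed

text \<open>The number of sets that may be given up when a star is removed from a ground set of \<open>i\<close> elements.
  The cut-off matters: the losses for all \<open>i\<close> up to \<open>n\<close> would add up to more than \<open>t ^ k\<close>.\<close>
definition peeling_loss :: "nat \<Rightarrow> nat \<Rightarrow> real \<Rightarrow> real \<Rightarrow> nat \<Rightarrow> real" where
  "peeling_loss n k B C i =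
     (if real i ^ (k - 1) < B * log 2 n then C * (log 2 n / real i ^ (k - 1) + log 2 i) else 0)"

text \<open>The heart of the lower bound: where the peeling stops, the two almost sure properties contradict each
  other. Below the cut-off every class is far from a star, so all classes together contain at
  most \<open>\<delta> * m ^ k\<close> sets. Above it, every class has at least one member missing its centre, and the blocked sets
  have no place.\<close>
lemma no_stable_partial_coloring:
  fixes \<delta> B C :: real
  assumes k: "k \<ge> 2" and n: "n \<ge> 2"
    and sp: "conflict_free_sparse n k X" and bl: "blocking n k B (3 * \<delta>) X"
    and S: "S \<subseteq> {1..n}" "k \<le> card S"
    and c: "\<And>s. s \<in> nsets S k - U \<Longrightarrow> c s \<in> K" "finite K" "card K \<le> card S"
    and U: "U \<subseteq> nsets S k" "real (card U) \<le> \<delta> * real (card S) ^ k"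
    and proper: "\<And>u v. {u, v} \<in> edges X \<Longrightarrow> c u \<noteq> c v"
    and \<delta>: "\<delta> > 0" "2 * \<delta> * real k ^ k < 1"
    and B: "B > 0" and C: "8 * real k * (real k + 1) \<le> C" "64 * real k / \<delta> \<le> C"
    and large: "4 * real k ^ 2 / \<delta> \<le> card S"
      "C * (card S / B + card S * log 2 (card S)) \<le> \<delta> * real (card S) ^ k"
    and stable: "\<And>j x. j \<in> K \<Longrightarrow> x \<in> S \<Longrightarrow>
        peeling_loss n k B C (card S) < real (card (residual (nsets S k - U) c j x))"
  shows False
proof -
  let ?m = "card S" and ?\<theta> = "C * (log 2 n / real (card S) ^ (k - 1) + log 2 (card S))"
  define A where "A = nsets S k - U"
  define J where "J = {j \<in> K. \<forall>x\<in>S. ?\<theta> \<le> real (card (residual A c j x))}"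
  have fS: "finite S" using S finite_subset by auto
  have m: "?m \<ge> 2" "S \<noteq> {}" using S k by auto
  have finA: "finite A" "A \<subseteq> nsets S k" using fS by (auto simp: A_def finite_imp_finite_nsets)
  have finU: "finite U" using U fS finite_subset finite_imp_finite_nsets by blast
  have mk: "real ?m * real ?m ^ (k - 1) = real ?m ^ k" using k by (simp flip: power_Suc)
  have "64 * real k / \<delta> > 0" using \<delta> k by simp
  hence "C > 0" using C(2) by linarith
  have J: "real (card {s \<in> A. c s \<in> J}) \<le> \<delta> * real ?m ^ k"
    using c proper by (intro card_spread_classes_le[OF k n sp S finA(2) _ c(2,3) _ \<delta>(1) C large(1)])
      (auto simp: J_def A_def)
  show False
  proof (cases "real ?m ^ (k - 1) < B * log 2 n")
    case True
    hence "J = K" using stable by (auto simp: J_def A_def peeling_loss_def intro: less_imp_le)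
    hence "nsets S k \<subseteq> {s \<in> A. c s \<in> J} \<union> U" using c by (auto simp: A_def)
    hence "card (nsets S k) \<le> card ({s \<in> A. c s \<in> J} \<union> U)" using finA finU by (intro card_mono) auto
    also have "\<dots> \<le> card {s \<in> A. c s \<in> J} + card U" by (rule card_Un_le)
    finally have "real (card (nsets S k)) \<le> 2 * \<delta> * real ?m ^ k" using J U(2) by linarith
    moreover have "(real ?m / real k) ^ k \<le> real (card (nsets S k))"
      using binomial_ge_n_over_k_pow_k[OF S(2), where 'a=real] by simp
    ultimately have "(real ?m / real k) ^ k \<le> 2 * \<delta> * real ?m ^ k" by linarith
    hence "real ?m ^ k \<le> (2 * \<delta> * real k ^ k) * real ?m ^ k"
      using k by (simp add: power_divide field_simps)
    also have "\<dots> < 1 * real ?m ^ k" using \<delta> m by (intro mult_strict_right_mono) auto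
    finally show False by simp
  next
    case False
    hence big: "B * log 2 n \<le> real ?m ^ (k - 1)" by simp
    have "\<exists>x\<in>S. \<forall>y\<in>S. card (residual A c j x) \<le> card (residual A c j y)" for j
      using ex_has_least_nat[of "\<lambda>x. x \<in> S" _ "\<lambda>x. card (residual A c j x)"] m by blast
    then obtain x where x: "\<And>j. x j \<in> S" "\<And>j y. y \<in> S \<Longrightarrow> card (residual A c j (x j)) \<le> card (residual A c j y)"
      by metis
    have "\<exists>b. b \<in> residual A c j (x j)" if "j \<in> K" for j
    proof -
      have "0 \<le> peeling_loss n k B C ?m" using False by (simp add: peeling_loss_def)
      hence "0 < real (card (residual A c j (x j)))"
        using stable[OF that x(1)] unfolding A_def by (meson le_less_trans)
      thus ?thesis by (metis card.empty equals0I of_nat_0 less_irrefl)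
    qed
    then obtain b where b: "\<And>j. j \<in> K \<Longrightarrow> b j \<in> residual A c j (x j)" by metis
    \<comment> \<open>An enumeration of the colours, as \<open>blocking\<close> speaks about classes numbered from \<open>0\<close>.\<close>
    obtain h where h: "bij_betw h {..<card K} K"
      using c(2) ex_bij_betw_nat_finite[of K] by (auto simp: atLeast0LessThan)
    let ?W = "witness_blocked k S (card K) (x \<circ> h) (b \<circ> h) X"
    have hK: "h i \<in> K" if "i < card K" for i using h that by (auto simp: bij_betw_def)
    have "\<forall>i<card K. (x \<circ> h) i \<in> S \<and> (b \<circ> h) i \<in> nsets S k \<and> (x \<circ> h) i \<notin> (b \<circ> h) i"
      using hK x(1) b finA(2) by (auto simp: residual_def subset_iff)
    hence lower: "3 * \<delta> * real ?m ^ k < real (card ?W)"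
      using bl S(1) big c(3) unfolding blocking_def by blast
    \<comment> \<open>A blocked set is uncoloured, in a class far from a star, or in the residual of its class.\<close>
    have "?W \<subseteq> U \<union> ({s \<in> A. c s \<in> J} \<union> (\<Union>j\<in>K - J. residual A c j (x j)))"
    proof
      fix s assume s: "s \<in> ?W"
      show "s \<in> U \<union> ({s \<in> A. c s \<in> J} \<union> (\<Union>j\<in>K - J. residual A c j (x j)))"
      proof (cases "s \<in> U \<or> c s \<in> J")
        case False
        have sA: "s \<in> A" using s False by (auto simp: A_def witness_blocked_def)
        hence csK: "c s \<in> K" using c by (auto simp: A_def)
        then obtain i where i: "i < card K" "h i = c s" using h by (metis bij_betw_iff_bijections lessThan_iff)
        have "x (c s) \<notin> s"
        proof
          assume "x (c s) \<in> s"
          hence "{s, b (c s)} \<in> edges X" using s i by (auto simp: witness_blocked_def)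
          hence "c s \<noteq> c (b (c s))" by (rule proper)
          thus False using b[OF csK] by (simp add: residual_def)
        qed
        thus ?thesis using sA csK False by (auto simp: residual_def)
      qed (use s in \<open>auto simp: A_def witness_blocked_def\<close>)
    qed
    hence "card ?W \<le> card (U \<union> ({s \<in> A. c s \<in> J} \<union> (\<Union>j\<in>K - J. residual A c j (x j))))"
      using finU finA c(2) by (intro card_mono) (auto simp: residual_def)
    also have "\<dots> \<le> card U + (card {s \<in> A. c s \<in> J} + card (\<Union>j\<in>K - J. residual A c j (x j)))"
      by (meson add_left_mono card_Un_le le_trans)
    also have "card (\<Union>j\<in>K - J. residual A c j (x j)) \<le> (\<Sum>j\<in>K - J. card (residual A c j (x j)))"
      using c(2) by (intro card_UN_le) auto
    finally have "real (card ?W) \<le> real (card U) + real (card {s \<in> A. c s \<in> J})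
        + (\<Sum>j\<in>K - J. real (card (residual A c j (x j))))" by (simp flip: of_nat_add of_nat_sum)
    also have "(\<Sum>j\<in>K - J. real (card (residual A c j (x j)))) \<le> (\<Sum>j\<in>K - J. ?\<theta>)"
    proof (intro sum_mono)
      fix j assume "j \<in> K - J"
      then obtain y where "y \<in> S" "real (card (residual A c j y)) < ?\<theta>" by (force simp: J_def)
      thus "real (card (residual A c j (x j))) \<le> ?\<theta>" using x(2)[of y j] by linarith
    qed
    also have "\<dots> \<le> ?m * ?\<theta>"
    proof -
      have "card (K - J) \<le> ?m" using c(2,3) card_mono[of K "K - J"] by auto
      moreover have "?\<theta> \<ge> 0" using \<open>C > 0\<close> m n by (intro mult_nonneg_nonneg add_nonneg_nonneg divide_nonneg_nonneg) auto
      ultimately show ?thesis by (simp add: mult_right_mono)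
    qed
    also have "?m * ?\<theta> \<le> \<delta> * real ?m ^ k"
    proof -
      have "log 2 n / real ?m ^ (k - 1) \<le> 1 / B" using big B m by (simp add: field_simps)
      hence "?m * ?\<theta> \<le> ?m * (C * (1 / B + log 2 ?m))"
        using \<open>0 < C\<close> by (intro mult_left_mono add_right_mono) auto
      also have "\<dots> = C * (?m / B + ?m * log 2 ?m)" by (simp add: algebra_simps)
      finally show ?thesis using large(2) by linarith
    qed
    finally have "real (card ?W) \<le> 3 * (\<delta> * real ?m ^ k)" using U(2) J by linarith
    with lower show False by simp
  qed
qed

text \<open>A good triple \<open>(S, K, U)\<close> is a stage of the peeling process: the remaining elements, the remaining colours
  and the sets given up so far. A good triple with \<open>S\<close> as small as possible is stable.\<close>
lemma chromatic_number_ge_if_conflict_free_sparse_blocking: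
  fixes \<delta> B C t :: real
  assumes k: "k \<ge> 2" and n: "n \<ge> 2"
    and X: "verts X = nsets {1..n} k" "edges X \<subseteq> edges (kneser_graph n k)"
    and sp: "conflict_free_sparse n k X" and bl: "blocking n k B (3 * \<delta>) X"
    and \<delta>: "\<delta> > 0" "2 * \<delta> * real k ^ k < 1"
    and B: "B > 0" and C: "8 * real k * (real k + 1) \<le> C" "64 * real k / \<delta> \<le> C"
    and t: "k \<le> t" "4 * real k ^ 2 / \<delta> \<le> t"
      "\<And>m::nat. t \<le> m \<Longrightarrow> C * (m / B + m * log 2 m) \<le> \<delta> * real m ^ k"
    and loss: "(\<Sum>i | t < real i \<and> i \<le> n. peeling_loss n k B C i) \<le> \<delta> * t ^ k"
  shows "real n - t \<le> real (chromatic_number X)"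
proof (rule ccontr)
  assume less: "\<not> real n - t \<le> real (chromatic_number X)"
  have "64 * real k / \<delta> > 0" using \<delta> k by simp
  hence "C > 0" using C(2) by linarith
  have loss_nonneg: "peeling_loss n k B C i \<ge> 0" if "t < real i" for i
    using \<open>C > 0\<close> that t(1) k n by (auto simp: peeling_loss_def intro!: mult_nonneg_nonneg add_nonneg_nonneg)
  have loss_le: "(\<Sum>i\<in>{m<..n}. peeling_loss n k B C i) \<le> \<delta> * real m ^ k" if "t \<le> real m" for m
  proof -
    have "(\<Sum>i\<in>{m<..n}. peeling_loss n k B C i) \<le> (\<Sum>i | t < real i \<and> i \<le> n. peeling_loss n k B C i)"
      using that loss_nonneg by (intro sum_mono2) auto
    also have "\<dots> \<le> \<delta> * t ^ k" by (rule loss)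
    also have "\<dots> \<le> \<delta> * real m ^ k" using \<delta> t that by (intro mult_left_mono power_mono) auto
    finally show ?thesis .
  qed
  let ?\<chi> = "chromatic_number X"
  obtain c where c: "proper_coloring X ?\<chi> c"
  proof -
    have "verts X = verts (kneser_graph n k)" using X(1) by (simp add: verts_def kneser_graph_def)
    moreover have "e \<subseteq> verts (kneser_graph n k) \<and> card e = 2" if "e \<in> edges X" for e
      using that X(2) k by (intro edges_kneser_graph) auto
    ultimately show ?thesis
      using proper_coloring_chromatic_number[of X] finite_verts_kneser_graph[of n k] that by auto
  qed
  hence proper: "c u \<noteq> c v" if "{u, v} \<in> edges X" for u v using that by (auto simp: proper_coloring_def)
  define good where "good = (\<lambda>(S, K, U). S \<subseteq> {1..n} \<and> K \<subseteq> {..<?\<chi>} \<and> real (card K) + t \<le> real (card S) \<and> U \<subseteq> nsets S k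
      \<and> real (card U) \<le> (\<Sum>i\<in>{card S<..n}. peeling_loss n k B C i) \<and> (\<forall>s\<in>nsets S k - U. c s \<in> K))"
  have "good ({1..n}, {..<?\<chi>}, {})"
    using c X less by (auto simp: good_def proper_coloring_def)
  then obtain p where p: "good p" "\<And>q. good q \<Longrightarrow> card (fst p) \<le> card (fst q)"
    using ex_has_least_nat[of good _ "\<lambda>p. card (fst p)"] by blast
  obtain S K U where pe: "p = (S, K, U)" by (cases p)
  have S: "S \<subseteq> {1..n}" "K \<subseteq> {..<?\<chi>}" "real (card K) + t \<le> real (card S)" "U \<subseteq> nsets S k"
    "real (card U) \<le> (\<Sum>i\<in>{card S<..n}. peeling_loss n k B C i)" "\<And>s. s \<in> nsets S k - U \<Longrightarrow> c s \<in> K"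
    using p(1) by (auto simp: good_def pe)
  have fS: "finite S" "finite K" using S(1,2) by (auto intro: finite_subset)
  have tm: "t \<le> real (card S)" using S(3) by linarith
  have stable: "peeling_loss n k B C (card S) < real (card (residual (nsets S k - U) c j x))"
    if j: "j \<in> K" and x: "x \<in> S" for j x
  proof (rule ccontr)
    let ?R = "residual (nsets S k - U) c j x"
    assume "\<not> ?thesis"
    hence R: "real (card ?R) \<le> peeling_loss n k B C (card S)" by simp
    define U' where "U' = nsets (S - {x}) k \<inter> (U \<union> ?R)"
    have cS: "card (S - {x}) = card S - 1" "card S \<ge> 1" "card S \<le> n"
      using x fS S(1) card_mono[of "{1..n}" S] by (auto simp: Suc_le_eq card_gt_0_iff)
    have cK: "card (K - {j}) = card K - 1" "card K \<ge> 1" using j fS by (auto simp: Suc_le_eq card_gt_0_iff)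
    have "card U' \<le> card (U \<union> ?R)" unfolding U'_def using finite_subset[OF S(4)] fS
      by (intro card_mono) (auto simp: residual_def finite_imp_finite_nsets)
    also have "\<dots> \<le> card U + card ?R" by (rule card_Un_le)
    finally have "real (card U') \<le> (\<Sum>i\<in>{card S<..n}. peeling_loss n k B C i) + peeling_loss n k B C (card S)"
      using S(5) R by linarith
    also have "\<dots> = (\<Sum>i\<in>insert (card S) {card S<..n}. peeling_loss n k B C i)" by simp
    also have "insert (card S) {card S<..n} = {card (S - {x})<..n}" using cS by auto
    finally have "real (card U') \<le> (\<Sum>i\<in>{card (S - {x})<..n}. peeling_loss n k B C i)" .
    moreover have "c s \<in> K - {j}" if "s \<in> nsets (S - {x}) k - U'" for s
    proof -
      have "s \<in> nsets S k" "x \<notin> s" "s \<notin> U" "s \<notin> ?R" using that by (auto simp: U'_def nsets_def)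
      thus ?thesis using S(6)[of s] by (auto simp: residual_def)
    qed
    moreover have "real (card (K - {j})) + t \<le> real (card (S - {x}))" using S(3) cS cK by simp
    ultimately have "good (S - {x}, K - {j}, U')"
      using S(1,2) by (auto simp: good_def U'_def)
    hence "card S \<le> card (S - {x})" using p(2) by (fastforce simp: pe)
    thus False using cS by simp
  qed
  show False
  proof (rule no_stable_partial_coloring[OF k n sp bl S(1) _ S(6) fS(2) _ S(4) _ proper \<delta> B C _ _ stable])
    show "k \<le> card S" "card K \<le> card S" using S(3) t(1) by linarith+
    show "real (card U) \<le> \<delta> * real (card S) ^ k" using S(5) loss_le[OF tm] by linarith
    show "4 * real k ^ 2 / \<delta> \<le> card S" using t(2) tm by simp
    show "C * (card S / B + card S * log 2 (card S)) \<le> \<delta> * real (card S) ^ k" by (rule t(3)[OF tm])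
  qed
qed

section \<open>The chromatic number of random Kneser graphs\<close>

theorem asymp_almost_surely_chromatic_number_le:
  fixes d D :: "nat \<Rightarrow> nat" and s :: "nat \<Rightarrow> nat \<Rightarrow> nat"
  assumes k: "k \<ge> 2"
    and d: "\<forall>\<^sub>F n in sequentially. d n \<le> D n" and D: "\<forall>\<^sub>F n in sequentially. real (D n) \<le> log 2 n"
    and s: "\<forall>\<^sub>F n in sequentially. \<forall>i. d n \<le> i \<and> i < D n \<longrightarrow> real (s n i * i ^ (k - 1)) \<le> log 2 n / 2"
    and anti: "\<forall>\<^sub>F n in sequentially. \<forall>i\<ge>d n. s n i \<le> s n (d n)"
    and big: "\<forall>\<^sub>F n in sequentially. d n ^ k + s n (d n) * d n \<le> (\<Sum>i\<in>{d n..<D n}. s n i)"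
  shows "asymp_almost_surely (\<lambda>n. random_kneser_graph n k (1/2))
           (\<lambda>n G. real (chromatic_number G) \<le> real n - real (d n))"
proof (rule asymp_almost_surely_mono[OF asymp_almost_surely_absorbing[OF k D]])
  have "\<forall>\<^sub>F n::nat in sequentially. log 2 n \<le> n" by real_asymp
  thus "\<forall>\<^sub>F n in sequentially. \<forall>G\<in>set_pmf (random_kneser_graph n k (1/2)).
      absorbing n k (D n) G \<longrightarrow> real (chromatic_number G) \<le> real n - real (d n)"
    using d D s anti big
  proof eventually_elim
    case (elim n)
    have dn: "d n \<le> n" using elim by linarith
    show ?case
    proof (intro ballI impI)
      fix G assume G: "G \<in> set_pmf (random_kneser_graph n k (1/2))" and abs: "absorbing n k (D n) G"
      note G' = set_pmf_random_kneser_graph[OF G]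
      have "colorable_on G (nsets {1..n} k) (n - d n)"
        using k elim dn by (intro colorable_on_if_absorbing[OF _ G'(2) abs, of "d n" "s n"]) auto
      hence "chromatic_number G \<le> n - d n"
      proof (intro chromatic_number_le_if_colorable_on)
        fix u v assume "{u, v} \<in> edges G"
        hence "{u, v} \<in> edges (kneser_graph n k)" using G'(2) by blast
        thus "u \<in> verts G \<and> v \<in> verts G" unfolding G'(1) in_edges_kneser_iff by blast
      qed (simp add: G')
      thus "real (chromatic_number G) \<le> real n - real (d n)" using dn by linarith
    qed
  qed
qed

text \<open>The constants depend on \<open>k\<close> only, so that \<open>t\<close> can be chosen afterwards, with a constant factor large
  in terms of them.\<close>
theorem asymp_almost_surely_chromatic_number_ge:
  assumes k: "k \<ge> 2"
  obtains \<delta> B C :: real where "\<delta> > 0" "B > 0" "C > 0"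
    "\<And>t :: nat \<Rightarrow> real. \<lbrakk>filterlim t at_top sequentially;
       \<forall>\<^sub>F n in sequentially. (\<Sum>i | t n < real i \<and> i \<le> n. peeling_loss n k B C i) \<le> \<delta> * t n ^ k\<rbrakk>
     \<Longrightarrow> asymp_almost_surely (\<lambda>n. random_kneser_graph n k (1/2))
           (\<lambda>n G. real n - t n \<le> real (chromatic_number G))"
proof -
  define \<eta> where "\<eta> = 1 / (4 * 4 ^ k * (2 * real k) ^ k)"
  define \<delta> where "\<delta> = \<eta> / 6"
  define B where "B = 2 * (real k + 6) / \<eta>"
  define C where "C = max (8 * real k * (real k + 1)) (64 * real k / \<delta>)"
  have pos: "\<eta> > 0" "\<delta> > 0" "B > 0" "C > 0" using k by (simp_all add: \<eta>_def \<delta>_def B_def C_def less_max_iff_disj)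
  have \<delta>k: "2 * \<delta> * real k ^ k < 1"
  proof -
    have "2 * \<delta> * real k ^ k = 1 / (12 * 4 ^ k * 2 ^ k)"
      using k by (simp add: \<delta>_def \<eta>_def power_mult_distrib)
    also have "12 * 4 ^ k * 2 ^ k = 12 * (8::real) ^ k" by (simp flip: power_mult_distrib)
    also have "1 / (12 * (8::real) ^ k) \<le> 1 / (12 * 1)" by (intro divide_left_mono mult_left_mono one_le_power) auto
    finally show ?thesis by simp
  qed
  have C: "8 * real k * (real k + 1) \<le> C" "64 * real k / \<delta> \<le> C" by (simp_all add: C_def)
  have "asymp_almost_surely (\<lambda>n. random_kneser_graph n k (1/2)) (\<lambda>n G. real n - t n \<le> real (chromatic_number G))"
    if t: "filterlim t at_top sequentially"
      and loss: "\<forall>\<^sub>F n in sequentially. (\<Sum>i | t n < real i \<and> i \<le> n. peeling_loss n k B C i) \<le> \<delta> * t n ^ k"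
    for t :: "nat \<Rightarrow> real"
  proof (rule asymp_almost_surely_mono[OF asymp_almost_surely_conj])
    show "asymp_almost_surely (\<lambda>n. random_kneser_graph n k (1/2)) (\<lambda>n G. conflict_free_sparse n k G)"
      by (rule asymp_almost_surely_conflict_free_sparse[OF k])
    show "asymp_almost_surely (\<lambda>n. random_kneser_graph n k (1/2)) (\<lambda>n G. blocking n k B (3 * \<delta>) G)"
    proof -
      have "3 * \<delta> = \<eta> / 2" by (simp add: \<delta>_def)
      thus ?thesis using asymp_almost_surely_blocking[OF k] unfolding B_def \<eta>_def by simp
    qed
    have "\<forall>\<^sub>F x::real in at_top. C * (x / B + x * log 2 x) \<le> \<delta> * x ^ 2" using pos by real_asymp
    hence "\<forall>\<^sub>F x::real in at_top. C * (x / B + x * log 2 x) \<le> \<delta> * x ^ k"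
      using eventually_ge_at_top[of 1]
    proof eventually_elim
      case (elim x)
      have "\<delta> * x ^ 2 \<le> \<delta> * x ^ k" using elim pos k by (intro mult_left_mono power_increasing) auto
      thus ?case using elim by linarith
    qed
    then obtain x0 where x0: "\<And>x. x \<ge> x0 \<Longrightarrow> C * (x / B + x * log 2 x) \<le> \<delta> * x ^ k"
      by (auto simp: eventually_at_top_linorder)
    have "\<forall>\<^sub>F n in sequentially. k \<le> t n" "\<forall>\<^sub>F n in sequentially. 4 * real k ^ 2 / \<delta> \<le> t n"
      "\<forall>\<^sub>F n in sequentially. x0 \<le> t n"
      using t unfolding filterlim_at_top by blast+
    thus "\<forall>\<^sub>F n in sequentially. \<forall>G\<in>set_pmf (random_kneser_graph n k (1/2)).
        conflict_free_sparse n k G \<and> blocking n k B (3 * \<delta>) G \<longrightarrow> real n - t n \<le> real (chromatic_number G)"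
      using loss eventually_ge_at_top[of 2]
    proof eventually_elim
      case (elim n)
      show ?case
      proof (intro ballI impI)
        fix G assume G: "G \<in> set_pmf (random_kneser_graph n k (1/2))"
          and "conflict_free_sparse n k G \<and> blocking n k B (3 * \<delta>) G"
        thus "real n - t n \<le> real (chromatic_number G)"
          using set_pmf_random_kneser_graph[OF G] elim x0
          by (intro chromatic_number_ge_if_conflict_free_sparse_blocking[OF k _ _ _ _ _ pos(2) \<delta>k pos(3) C]) auto
      qed
    qed
  qed
  thus ?thesis using that pos by blast
qed

lemma eventually_log2_compose:
  assumes "eventually P at_top"
  shows "\<forall>\<^sub>F n::nat in sequentially. P (log 2 n)"
proof -
  have "filterlim (\<lambda>n::nat. log 2 n) at_top sequentially" by real_asymp
  thus ?thesis using assms by (rule eventually_compose_filterlim[rotated])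
qed

text \<open>Here \<open>\<mu>\<close> bounds the elements below the cut-off of \<open>peeling_loss\<close>.\<close>
lemma sum_peeling_loss_le:
  assumes t: "t \<ge> 1" and C: "C \<ge> 0" and n: "n \<ge> 1" and \<mu>: "\<mu> \<ge> 1"
    "\<And>i::nat. real i ^ (k - 1) < B * log 2 n \<Longrightarrow> real i \<le> \<mu>"
  shows "(\<Sum>i | t < real i \<and> i \<le> n. peeling_loss n k B C i)
     \<le> C * (log 2 n * (\<Sum>i\<in>{nat \<lfloor>t\<rfloor><..nat \<lfloor>\<mu>\<rfloor>}. 1 / real i ^ (k - 1)) + \<mu> * log 2 \<mu>)"
proof -
  let ?N = "{nat \<lfloor>t\<rfloor><..nat \<lfloor>\<mu>\<rfloor>}"
  have "(\<Sum>i | t < real i \<and> i \<le> n. peeling_loss n k B C i)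
      = (\<Sum>i | (t < real i \<and> i \<le> n) \<and> real i ^ (k - 1) < B * log 2 n. C * (log 2 n / real i ^ (k - 1) + log 2 i))"
    unfolding peeling_loss_def by (subst sum.inter_filter[symmetric]) auto
  also have "\<dots> \<le> (\<Sum>i\<in>?N. C * (log 2 n / real i ^ (k - 1) + log 2 \<mu>))"
  proof (rule sum_le_included[of _ _ _ id])
    show "\<forall>i\<in>?N. 0 \<le> C * (log 2 n / real i ^ (k - 1) + log 2 \<mu>)"
      using C n \<mu>(1) by auto
    show "\<forall>i\<in>{i. (t < real i \<and> i \<le> n) \<and> real i ^ (k - 1) < B * log 2 n}. \<exists>j\<in>?N. id j = i \<and>
       C * (log 2 n / real i ^ (k - 1) + log 2 i) \<le> C * (log 2 n / real j ^ (k - 1) + log 2 \<mu>)"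
    proof (intro ballI)
      fix i assume i: "i \<in> {i. (t < real i \<and> i \<le> n) \<and> real i ^ (k - 1) < B * log 2 n}"
      hence "real i \<le> \<mu>" "t < real i" using \<mu>(2) by auto
      hence "i \<in> ?N" using t by (auto simp: le_nat_floor) linarith
      moreover have "log 2 i \<le> log 2 \<mu>" using \<open>real i \<le> \<mu>\<close> \<open>t < real i\<close> t by simp
      ultimately show "\<exists>j\<in>?N. id j = i \<and>
          C * (log 2 n / real i ^ (k - 1) + log 2 i) \<le> C * (log 2 n / real j ^ (k - 1) + log 2 \<mu>)"
        using C by (intro bexI[of _ i]) (auto intro!: mult_left_mono)
    qed
  qed auto
  also have "\<dots> = C * (log 2 n * (\<Sum>i\<in>?N. 1 / real i ^ (k - 1)) + real (card ?N) * log 2 \<mu>)"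
    by (simp add: sum.distrib sum_distrib_left distrib_left mult_ac divide_inverse)
  also have "\<dots> \<le> C * (log 2 n * (\<Sum>i\<in>?N. 1 / real i ^ (k - 1)) + \<mu> * log 2 \<mu>)"
  proof (intro mult_left_mono add_left_mono mult_right_mono)
    have "real (card ?N) \<le> real (nat \<lfloor>\<mu>\<rfloor>)" by simp
    also have "\<dots> \<le> \<mu>" using \<mu>(1) by simp
    finally show "real (card ?N) \<le> \<mu>" .
  qed (use C \<mu>(1) in auto)
  finally show ?thesis .
qed

lemma sum_inverse_le_ln: "1 \<le> a \<Longrightarrow> (\<Sum>i\<in>{a<..b}. 1 / real i) \<le> ln (max 1 (real b))"
proof (induction b)
  case (Suc b)
  show ?case
  proof (cases "a \<le> b")
    case True
    have "1 / real (Suc b) \<le> ln (real (Suc b)) - ln (real b)"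
    proof -
      have "ln (real b / real (Suc b)) \<le> real b / real (Suc b) - 1"
        using True Suc.prems by (intro ln_le_minus_one) auto
      also have "\<dots> = - (1 / real (Suc b))" by (simp add: field_simps)
      finally show ?thesis using True Suc.prems by (simp add: ln_div)
    qed
    moreover have "{a<..Suc b} = insert (Suc b) {a<..b}" using True by auto
    moreover have "max 1 (real b) = real b" "max 1 (real (Suc b)) = real (Suc b)" using True Suc.prems by auto
    ultimately show ?thesis using Suc by simp
  qed auto
qed auto

lemma ln_ratio_le_sum_inverse:
  assumes "1 \<le> a" "a \<le> b"
  shows "ln (real b / real a) \<le> (\<Sum>i\<in>{a..<b}. 1 / real i)"
  using assms(2)
proof (induction b rule: dec_induct)
  case (step b)
  have b: "b \<ge> 1" using step assms by simp
  have "ln (real (Suc b) / real b) \<le> real (Suc b) / real b - 1" using b by (intro ln_le_minus_one) auto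
  also have "\<dots> = 1 / real b" using b by (simp add: field_simps)
  finally have "ln (real (Suc b)) - ln (real b) \<le> 1 / real b" using b by (simp add: ln_div)
  thus ?case using step assms b by (simp add: ln_div)
qed (use assms in simp)

lemma sum_inverse_squares_le: "1 \<le> a \<Longrightarrow> (\<Sum>i\<in>{a<..b}. 1 / real i ^ 2) \<le> 1 / real a"
proof -
  assume a: "1 \<le> a"
  have "(\<Sum>i\<in>{a<..b}. 1 / real i ^ 2) \<le> 1 / real a - 1 / real b" if "a \<le> b"
    using that
  proof (induction b rule: dec_induct)
    case (step b)
    have "1 / real (Suc b) ^ 2 \<le> 1 / (real b * real (Suc b))"
      using step a by (intro divide_left_mono) (auto simp: power2_eq_square intro!: mult_right_mono)
    also have "\<dots> = 1 / real b - 1 / real (Suc b)" using step a by (simp add: field_simps)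
    moreover have "{a<..Suc b} = insert (Suc b) {a<..b}" using step by auto
    ultimately show ?case using step by simp
  qed simp
  thus ?thesis by (cases "a \<le> b") (auto intro: order_trans)
qed

lemma filterlim_log2_powr_at_top:
  "a > 0 \<Longrightarrow> filterlim (\<lambda>n::nat. log 2 n powr a) at_top sequentially"
  by real_asymp

text \<open>With \<open>y ^ (2 * k - 2) = L\<close> and \<open>t = c * y\<close>, the losses add up to the order of \<open>L / t ^ (k - 2)\<close>, which is small
  against \<open>t ^ k\<close> for large \<open>c\<close>; the logarithmic part is of order \<open>y ^ 2 * log 2 y\<close> and negligible.\<close>
proposition kneser_lower_ge3:
  assumes k: "k \<ge> 3"
  obtains c2 :: real where "c2 > 0"
    "asymp_almost_surely (\<lambda>n. random_kneser_graph n k (1/2))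
       (\<lambda>n G. real n - c2 * log 2 n powr (1 / (2 * real k - 2)) \<le> real (chromatic_number G))"
proof -
  obtain \<delta> B C :: real where pos: "\<delta> > 0" "B > 0" "C > 0"
    and ge: "\<And>t :: nat \<Rightarrow> real. \<lbrakk>filterlim t at_top sequentially;
       \<forall>\<^sub>F n in sequentially. (\<Sum>i | t n < real i \<and> i \<le> n. peeling_loss n k B C i) \<le> \<delta> * t n ^ k\<rbrakk>
     \<Longrightarrow> asymp_almost_surely (\<lambda>n. random_kneser_graph n k (1/2))
           (\<lambda>n G. real n - t n \<le> real (chromatic_number G))"
    by (rule asymp_almost_surely_chromatic_number_ge[OF order_trans[OF _ k]]) simp_all
  \<comment> \<open>\<open>c\<close> ensures \<open>4 * C * L \<le> \<delta> * t ^ (2 * k - 2)\<close>; \<open>B1 * y ^ 2\<close> bounds the elements below the cut-off.\<close>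
  define c where "c = max 1 (4 * C / \<delta>)"
  define B1 where "B1 = max 1 B"
  define y where "y = (\<lambda>n::nat. log 2 n powr (1 / (2 * real k - 2)))"
  have k2: "2 * real k - 2 > 0" using k by simp
  have c1: "c \<ge> 1" by (simp add: c_def)
  have y_top: "filterlim y at_top sequentially"
    unfolding y_def using k2 by (intro filterlim_log2_powr_at_top) simp
  have asy: "\<forall>\<^sub>F x::real in at_top. C * (B1 * x ^ 2 * log 2 (B1 * x ^ 2)) \<le> \<delta> / 2 * x ^ 3"
  proof -
    have "B1 > 0" by (simp add: B1_def)
    thus ?thesis using pos by real_asymp
  qed
  have "asymp_almost_surely (\<lambda>n. random_kneser_graph n k (1/2)) (\<lambda>n G. real n - c * y n \<le> real (chromatic_number G))"
  proof (rule ge)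
    show "filterlim (\<lambda>n. c * y n) at_top sequentially"
      using c1 by (intro filterlim_tendsto_pos_mult_at_top[OF tendsto_const _ y_top]) auto
    have "\<forall>\<^sub>F n in sequentially. C * (B1 * y n ^ 2 * log 2 (B1 * y n ^ 2)) \<le> \<delta> / 2 * y n ^ 3"
      using asy y_top by (rule eventually_compose_filterlim)
    moreover have "\<forall>\<^sub>F n in sequentially. 1 \<le> y n" using y_top unfolding filterlim_at_top by blast
    ultimately show "\<forall>\<^sub>F n in sequentially. (\<Sum>i | c * y n < real i \<and> i \<le> n. peeling_loss n k B C i) \<le> \<delta> * (c * y n) ^ k"
      using eventually_ge_at_top[of 2]
    proof eventually_elim
      case (elim n)
      let ?t = "c * y n" and ?L = "log 2 n" and ?\<mu> = "B1 * y n ^ 2"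
      have yL: "y n ^ (2 * k - 2) = ?L"
      proof -
        have "y n ^ (2 * k - 2) = y n powr real (2 * k - 2)" using elim by (intro powr_realpow[symmetric]) auto
        also have "real (2 * k - 2) = 2 * real k - 2" using k by (simp add: of_nat_diff)
        finally show ?thesis using k2 elim by (simp add: y_def powr_powr)
      qed
      have t1: "?t \<ge> 1" "?t \<ge> y n" using c1 elim mult_mono[of 1 c 1 "y n"] mult_right_mono[of 1 c "y n"] by auto
      have \<mu>1: "?\<mu> \<ge> 1" using elim mult_mono[of 1 B1 1 "y n ^ 2"] one_le_power[of "y n" 2] by (simp add: B1_def)
      have \<mu>: "real i \<le> ?\<mu>" if "real i ^ (k - 1) < B * ?L" for i :: nat
      proof -
        have "2 * k - 2 = 2 * (k - 1)" by simp
        hence "?L = (y n ^ 2) ^ (k - 1)" by (simp add: yL[symmetric] power_mult)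
        moreover have "B \<le> B1 ^ (k - 1)" using k self_le_power[of B1 "k - 1"] by (simp add: B1_def)
        ultimately have "B * ?L \<le> B1 ^ (k - 1) * (y n ^ 2) ^ (k - 1)" by (simp add: mult_right_mono)
        hence "real i ^ (k - 1) < ?\<mu> ^ (k - 1)" using that by (simp add: power_mult_distrib)
        moreover have "0 \<le> ?\<mu>" using \<mu>1 by linarith
        ultimately have "real i < ?\<mu>" by (rule power_less_imp_less_base)
        thus ?thesis by simp
      qed
      have "(\<Sum>i\<in>{nat \<lfloor>?t\<rfloor><..nat \<lfloor>?\<mu>\<rfloor>}. 1 / real i ^ (k - 1)) \<le> 2 / ?t ^ (k - 2)"
      proof -
        have fl: "1 \<le> nat \<lfloor>?t\<rfloor>" using t1 by (simp add: le_nat_floor)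
        have "(\<Sum>i\<in>{nat \<lfloor>?t\<rfloor><..nat \<lfloor>?\<mu>\<rfloor>}. 1 / real i ^ (k - 1))
            \<le> (\<Sum>i\<in>{nat \<lfloor>?t\<rfloor><..nat \<lfloor>?\<mu>\<rfloor>}. 1 / ?t ^ (k - 3) * (1 / real i ^ 2))"
        proof (intro sum_mono)
          fix i assume "i \<in> {nat \<lfloor>?t\<rfloor><..nat \<lfloor>?\<mu>\<rfloor>}"
          hence i: "?t \<le> real i" using t1 by (simp add: nat_less_iff floor_less_iff)
          hence "0 < real i" using t1 by linarith
          have "k - 1 = (k - 3) + 2" using k by simp
          hence "real i ^ (k - 1) = real i ^ (k - 3) * real i ^ 2" by (metis power_add)
          moreover have "?t ^ (k - 3) * real i ^ 2 \<le> real i ^ (k - 3) * real i ^ 2"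
            using i t1 by (intro mult_right_mono power_mono) auto
          moreover have "0 < ?t ^ (k - 3) * real i ^ 2" 
            using \<open>0 < real i\<close> c1 elim by (intro mult_pos_pos zero_less_power) auto
          ultimately have "1 / real i ^ (k - 1) \<le> 1 / (?t ^ (k - 3) * real i ^ 2)"
            by (intro divide_left_mono) (auto intro: mult_pos_pos)
          thus "1 / real i ^ (k - 1) \<le> 1 / ?t ^ (k - 3) * (1 / real i ^ 2)" by simp
        qed
        also have "\<dots> = 1 / ?t ^ (k - 3) * (\<Sum>i\<in>{nat \<lfloor>?t\<rfloor><..nat \<lfloor>?\<mu>\<rfloor>}. 1 / real i ^ 2)"
          by (simp only: sum_distrib_left)
        also have "\<dots> \<le> 1 / ?t ^ (k - 3) * (1 / real (nat \<lfloor>?t\<rfloor>))"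
          using t1 fl by (intro mult_left_mono sum_inverse_squares_le) auto
        also have "\<dots> \<le> 1 / ?t ^ (k - 3) * (2 / ?t)"
        proof (intro mult_left_mono)
          have "?t \<le> 2 * real (nat \<lfloor>?t\<rfloor>)" using t1 fl by linarith
          thus "1 / real (nat \<lfloor>?t\<rfloor>) \<le> 2 / ?t" using t1 fl by (simp add: field_simps)
        qed (use t1 in simp)
        also have "\<dots> = 2 / ?t ^ (k - 2)"
        proof -
          have "k - 2 = Suc (k - 3)" using k by simp
          thus ?thesis by simp
        qed
        finally show ?thesis .
      qed
      hence "?L * (\<Sum>i\<in>{nat \<lfloor>?t\<rfloor><..nat \<lfloor>?\<mu>\<rfloor>}. 1 / real i ^ (k - 1)) \<le> ?L * (2 / ?t ^ (k - 2))"
        using elim by (intro mult_left_mono) auto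
      moreover have "C * (?L * (2 / ?t ^ (k - 2))) \<le> \<delta> / 2 * ?t ^ k"
      proof -
        have "4 * C * ?L \<le> \<delta> * c * ?L" using pos elim by (intro mult_right_mono) (auto simp: c_def max_def field_simps)
        also have "\<dots> \<le> \<delta> * c ^ (2 * k - 2) * ?L"
          using pos elim c1 k by (intro mult_right_mono mult_left_mono self_le_power) auto
        also have "\<dots> = \<delta> * ?t ^ (2 * k - 2)" by (simp add: power_mult_distrib yL)
        also have "2 * k - 2 = k + (k - 2)" using k by simp
        finally have "4 * C * ?L \<le> \<delta> * ?t ^ k * ?t ^ (k - 2)" by (simp only: power_add mult.assoc)
        moreover have "0 < ?t ^ (k - 2)" using t1 by simp
        ultimately show ?thesis by (simp add: field_simps)
      qed
      moreover have "C * (?\<mu> * log 2 ?\<mu>) \<le> \<delta> / 2 * ?t ^ k"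
      proof -
        have "y n ^ 3 \<le> y n ^ k" using elim k by (intro power_increasing) auto
        also have "\<dots> \<le> ?t ^ k" using t1 elim by (intro power_mono) auto
        finally have "\<delta> / 2 * y n ^ 3 \<le> \<delta> / 2 * ?t ^ k" using pos by (intro mult_left_mono) auto
        thus ?thesis using elim by linarith
      qed
      ultimately have "C * (?L * (\<Sum>i\<in>{nat \<lfloor>?t\<rfloor><..nat \<lfloor>?\<mu>\<rfloor>}. 1 / real i ^ (k - 1)) + ?\<mu> * log 2 ?\<mu>) \<le> \<delta> * ?t ^ k"
        using mult_left_mono[of _ _ C] pos unfolding distrib_left by fastforce
      thus ?case using sum_peeling_loss_le[of ?t C n ?\<mu> k B] t1 pos elim \<mu>1 \<mu> by fastforce
    qed
  qed
  thus ?thesis using that[of c] c1 unfolding y_def by simp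
qed

text \<open>The cut-off is at \<open>B * L\<close>, and both the harmonic part \<open>L * ln (B * L)\<close> and the logarithmic part of the
  losses are of the order of \<open>L * log 2 L\<close>, just as \<open>t ^ 2\<close>.\<close>
proposition kneser_lower_2:
  obtains c2 :: real where "c2 > 0"
    "asymp_almost_surely (\<lambda>n. random_kneser_graph n 2 (1/2))
       (\<lambda>n G. real n - c2 * sqrt (log 2 n * log 2 (log 2 n)) \<le> real (chromatic_number G))"
proof -
  obtain \<delta> B C :: real where pos: "\<delta> > 0" "B > 0" "C > 0"
    and ge: "\<And>t :: nat \<Rightarrow> real. \<lbrakk>filterlim t at_top sequentially;
       \<forall>\<^sub>F n in sequentially. (\<Sum>i | t n < real i \<and> i \<le> n. peeling_loss n 2 B C i) \<le> \<delta> * t n ^ 2\<rbrakk>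
     \<Longrightarrow> asymp_almost_surely (\<lambda>n. random_kneser_graph n 2 (1/2))
           (\<lambda>n G. real n - t n \<le> real (chromatic_number G))"
    by (rule asymp_almost_surely_chromatic_number_ge[of 2]) simp_all
  define c where "c = sqrt (C * (2 + 2 * B) / \<delta>)"
  have c: "c > 0" "\<delta> * c ^ 2 = C * (2 + 2 * B)" using pos by (simp_all add: c_def)
  have "asymp_almost_surely (\<lambda>n. random_kneser_graph n 2 (1/2))
     (\<lambda>n G. real n - c * sqrt (log 2 n * log 2 (log 2 n)) \<le> real (chromatic_number G))"
  proof (rule ge)
    show "filterlim (\<lambda>n::nat. c * sqrt (log 2 n * log 2 (log 2 n))) at_top sequentially"
      using c(1) by real_asymp
    have "\<forall>\<^sub>F n::nat in sequentially. 1 \<le> c * sqrt (log 2 n * log 2 (log 2 n))" using c(1) by real_asymp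
    moreover have "\<forall>\<^sub>F x::real in at_top. 1 \<le> B * x \<and> B \<le> x \<and> 2 \<le> x" using pos by (intro eventually_conj) real_asymp+
    hence "\<forall>\<^sub>F n::nat in sequentially. 1 \<le> B * log 2 n \<and> B \<le> log 2 n \<and> 2 \<le> log 2 n" by (rule eventually_log2_compose)
    ultimately show "\<forall>\<^sub>F n in sequentially.
      (\<Sum>i | c * sqrt (log 2 n * log 2 (log 2 n)) < real i \<and> i \<le> n. peeling_loss n 2 B C i)
        \<le> \<delta> * (c * sqrt (log 2 n * log 2 (log 2 n))) ^ 2"
      using eventually_ge_at_top[of 2]
    proof eventually_elim
      case (elim n)
      let ?L = "log 2 n" and ?t = "c * sqrt (log 2 n * log 2 (log 2 n))"
      let ?l = "log 2 ?L" and ?\<mu> = "B * ?L"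
      have l1: "?l \<ge> 1" using elim by simp
      have "?\<mu> \<le> ?L * ?L" using elim by (intro mult_right_mono) auto
      hence "log 2 ?\<mu> \<le> log 2 (?L * ?L)" using elim by simp
      also have "\<dots> = 2 * ?l" using elim by (simp add: log_mult)
      finally have log\<mu>: "log 2 ?\<mu> \<le> 2 * ?l" .
      have "(\<Sum>i\<in>{nat \<lfloor>?t\<rfloor><..nat \<lfloor>?\<mu>\<rfloor>}. 1 / real i) \<le> ln (max 1 (real (nat \<lfloor>?\<mu>\<rfloor>)))"
        using elim by (intro sum_inverse_le_ln) (simp add: le_nat_floor)
      also have "\<dots> \<le> ln ?\<mu>" using elim by (intro ln_mono) auto
      also have "\<dots> \<le> log 2 ?\<mu>"
      proof -
        have "ln ?\<mu> \<ge> 0" using elim by simp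
        hence "ln ?\<mu> * ln 2 \<le> ln ?\<mu>" using ln_2_less_1 by (intro mult_left_le) auto
        thus ?thesis by (simp add: log_def field_simps)
      qed
      also note log\<mu>
      finally have sum: "(\<Sum>i\<in>{nat \<lfloor>?t\<rfloor><..nat \<lfloor>?\<mu>\<rfloor>}. 1 / real i) \<le> 2 * ?l" .
      have "(\<Sum>i | ?t < real i \<and> i \<le> n. peeling_loss n 2 B C i)
        \<le> C * (?L * (\<Sum>i\<in>{nat \<lfloor>?t\<rfloor><..nat \<lfloor>?\<mu>\<rfloor>}. 1 / real i) + ?\<mu> * log 2 ?\<mu>)"
        using sum_peeling_loss_le[of ?t C n ?\<mu> 2 B] elim pos by simp
      also have "\<dots> \<le> C * (?L * (2 * ?l) + ?\<mu> * (2 * ?l))"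
        using sum log\<mu> elim pos by (intro mult_left_mono add_mono) auto
      also have "\<dots> = \<delta> * c ^ 2 * (?L * ?l)" unfolding c(2) by (simp add: algebra_simps)
      also have "\<dots> = \<delta> * ?t ^ 2" using l1 elim by (simp add: power_mult_distrib)
      finally show ?case .
    qed
  qed
  thus ?thesis using that c(1) by blast
qed

text \<open>The same number of core sets is hidden in each of \<open>2 * d\<close> steps, namely at least \<open>d ^ (k - 1)\<close>; half of
  the steps would suffice for the core itself, the other half pays for the steps that hide fewer sets. The factor
  \<open>1 / 12\<close> makes \<open>2 * (3 * d) ^ (k - 1) * d ^ (k - 1) \<le> L\<close>.\<close>
proposition kneser_upper_ge3:
  assumes k: "k \<ge> 3"
  shows "asymp_almost_surely (\<lambda>n. random_kneser_graph n k (1/2))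
       (\<lambda>n G. real (chromatic_number G) \<le> real n - 1 / 12 * log 2 n powr (1 / (2 * real k - 2)))"
proof -
  define y where "y = (\<lambda>n::nat. log 2 n powr (1 / (2 * real k - 2)))"
  define d where "d = (\<lambda>n. nat \<lceil>y n / 12\<rceil>)"
  define s where "s = (\<lambda>n (i::nat). nat \<lfloor>log 2 n / (2 * real (3 * d n) ^ (k - 1))\<rfloor>)"
  have k2: "2 * real k - 2 > 0" using k by simp
  have y_top: "filterlim y at_top sequentially"
    unfolding y_def using k2 by (intro filterlim_log2_powr_at_top) simp
  have "\<forall>\<^sub>F n in sequentially. 12 \<le> y n" using y_top unfolding filterlim_at_top by blast
  hence ev: "\<forall>\<^sub>F n in sequentially. 1 \<le> d n \<and> real (3 * d n) \<le> y n / 2 \<and> y n ^ (2 * k - 2) = log 2 n \<and> 12 \<le> y n \<and> 2 \<le> n"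
    using eventually_ge_at_top[of 2]
  proof eventually_elim
    case (elim n)
    have "y n ^ (2 * k - 2) = y n powr real (2 * k - 2)" using elim by (intro powr_realpow[symmetric]) auto
    also have "real (2 * k - 2) = 2 * real k - 2" using k by (simp add: of_nat_diff)
    finally have "y n ^ (2 * k - 2) = log 2 n" using k2 elim by (simp add: y_def powr_powr)
    moreover have "real (3 * d n) \<le> y n / 2" "1 \<le> d n" using elim unfolding d_def by linarith+
    ultimately show ?case using elim by simp
  qed
  have "asymp_almost_surely (\<lambda>n. random_kneser_graph n k (1/2))
       (\<lambda>n G. real (chromatic_number G) \<le> real n - real (d n))"
  proof (rule asymp_almost_surely_chromatic_number_le[where D = "\<lambda>n. 3 * d n" and s = s])
    show "k \<ge> 2" using k by simp
    show "\<forall>\<^sub>F n in sequentially. real (3 * d n) \<le> log 2 n"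
      using ev
    proof eventually_elim
      case (elim n)
      have "y n \<le> y n ^ (2 * k - 2)" using elim k by (intro self_le_power) auto
      thus ?case using elim by linarith
    qed
    show "\<forall>\<^sub>F n in sequentially. \<forall>i. d n \<le> i \<and> i < 3 * d n \<longrightarrow> real (s n i * i ^ (k - 1)) \<le> log 2 n / 2"
      using ev
    proof (eventually_elim, intro allI impI)
      fix n i assume *: "1 \<le> d n \<and> real (3 * d n) \<le> y n / 2 \<and> y n ^ (2 * k - 2) = log 2 n \<and> 12 \<le> y n \<and> 2 \<le> n"
        and i: "d n \<le> i \<and> i < 3 * d n"
      have "real (s n i * i ^ (k - 1)) \<le> log 2 n / (2 * real (3 * d n) ^ (k - 1)) * real (3 * d n) ^ (k - 1)"
        unfolding of_nat_mult of_nat_power s_def using * i by (intro mult_mono power_mono) auto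
      also have "\<dots> = log 2 n / 2" using * by simp
      finally show "real (s n i * i ^ (k - 1)) \<le> log 2 n / 2" .
    qed
    show "\<forall>\<^sub>F n in sequentially. d n ^ k + s n (d n) * d n \<le> (\<Sum>i\<in>{d n..<3 * d n}. s n i)"
      using ev
    proof eventually_elim
      case (elim n)
      have "(\<Sum>i\<in>{d n..<3 * d n}. s n i) = d n * s n (d n) + s n (d n) * d n" by (simp add: s_def)
      moreover have "d n ^ (k - 1) \<le> s n (d n)"
      proof -
        have "2 * real (3 * d n) ^ (k - 1) * real (d n) ^ (k - 1) \<le> y n ^ (k - 1) * y n ^ (k - 1)"
        proof (intro mult_mono)
          have "2 * real (3 * d n) ^ (k - 1) \<le> 2 * (y n / 2) ^ (k - 1)" using elim by (intro mult_left_mono power_mono) auto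
          also have "\<dots> = 2 / 2 ^ (k - 1) * y n ^ (k - 1)" by (simp add: power_divide)
          also have "\<dots> \<le> 1 * y n ^ (k - 1)"
            using elim k self_le_power[of "2::real" "k - 1"] by (intro mult_right_mono) auto
          finally show "2 * real (3 * d n) ^ (k - 1) \<le> y n ^ (k - 1)" by simp
          show "real (d n) ^ (k - 1) \<le> y n ^ (k - 1)" using elim by (intro power_mono) auto
        qed (use elim in auto)
        also have "\<dots> = log 2 n"
        proof -
          have "2 * k - 2 = (k - 1) + (k - 1)" by simp
          thus ?thesis using elim by (metis power_add)
        qed
        finally have "real (d n ^ (k - 1)) \<le> log 2 n / (2 * real (3 * d n) ^ (k - 1))"
          using elim by (simp add: field_simps)
        thus ?thesis unfolding s_def by (rule le_nat_floor)
      qed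
      hence "d n * d n ^ (k - 1) \<le> d n * s n (d n)" by (rule mult_le_mono2)
      moreover have "d n * d n ^ (k - 1) = d n ^ k" using k by (simp flip: power_Suc)
      ultimately show ?case by linarith
    qed
  qed (auto simp: s_def)
  moreover have "y n / 12 \<le> real (d n)" for n unfolding d_def by linarith
  hence "real n - real (d n) \<le> real n - 1 / 12 * log 2 n powr (1 / (2 * real k - 2))" for n
    by (simp add: y_def)
  ultimately show ?thesis
    by (elim asymp_almost_surely_mono) (intro always_eventually allI ballI impI, erule order_trans)
qed

text \<open>The steps run from \<open>d\<close> up to \<open>L / 4\<close>, far beyond \<open>d\<close>, and step \<open>i\<close> hides about \<open>L / (2 * i)\<close> pairs. The
  harmonic sum gains the factor \<open>ln (L / d)\<close>, which is of the order of \<open>log 2 L\<close>.\<close>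
proposition kneser_upper_2:
  "asymp_almost_surely (\<lambda>n. random_kneser_graph n 2 (1/2))
     (\<lambda>n G. real (chromatic_number G) \<le> real n - 1 / 16 * sqrt (log 2 n * log 2 (log 2 n)))"
proof -
  define r where "r = (\<lambda>x. sqrt (x * log 2 x) / 16)"
  define d where "d = (\<lambda>n::nat. nat \<lceil>r (log 2 n)\<rceil>)"
  define D where "D = (\<lambda>n::nat. nat \<lfloor>log 2 n / 4\<rfloor>)"
  define s where "s = (\<lambda>n (i::nat). nat \<lfloor>log 2 (real n) / (2 * real i)\<rfloor>)"
  have "\<forall>\<^sub>F x::real in at_top. 1 \<le> r x \<and> 2 * r x \<le> x / 8 \<and> 8 \<le> x
      \<and> (2 * r x) ^ 2 + x / 2 \<le> x / 4 * ln (x / 8 / (2 * r x))"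
  proof (intro eventually_conj)
    have "\<forall>\<^sub>F x::real in at_top. x * ln x / 32 + x / 2 \<le> x / 4 * ln (x / 8 / (2 * r x))"
      unfolding r_def by real_asymp
    thus "\<forall>\<^sub>F x::real in at_top. (2 * r x) ^ 2 + x / 2 \<le> x / 4 * ln (x / 8 / (2 * r x))"
      using eventually_ge_at_top[of 1]
    proof eventually_elim
      case (elim x)
      have "log 2 x \<le> 2 * ln x"
      proof -
        have "ln x * 1 \<le> ln x * (2 * ln 2)" using elim ln2_ge_two_thirds by (intro mult_left_mono) auto
        thus ?thesis by (simp add: log_def field_simps)
      qed
      hence "x * log 2 x / 64 \<le> x * (2 * ln x) / 64" using elim by (intro divide_right_mono mult_left_mono) auto
      moreover have "(2 * r x) ^ 2 = x * log 2 x / 64"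
        using elim by (simp add: r_def power_mult_distrib power_divide)
      ultimately show ?case using elim by linarith
    qed
  qed (unfold r_def, real_asymp+)
  hence "\<forall>\<^sub>F n::nat in sequentially. 1 \<le> r (log 2 n) \<and> 2 * r (log 2 n) \<le> log 2 n / 8 \<and> 8 \<le> log 2 n
      \<and> (2 * r (log 2 n)) ^ 2 + log 2 n / 2 \<le> log 2 n / 4 * ln (log 2 n / 8 / (2 * r (log 2 n)))"
    by (rule eventually_log2_compose)
  hence ev: "\<forall>\<^sub>F n::nat in sequentially. 1 \<le> d n \<and> d n \<le> D n \<and> real (d n) \<le> 2 * r (log 2 n)
      \<and> log 2 n / 8 \<le> real (D n) \<and> real (D n) \<le> log 2 n / 4 \<and> 8 \<le> log 2 n
      \<and> (2 * r (log 2 n)) ^ 2 + log 2 n / 2 \<le> log 2 n / 4 * ln (log 2 n / 8 / (2 * r (log 2 n)))"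
  proof eventually_elim
    case (elim n)
    have d: "1 \<le> d n" "real (d n) \<le> 2 * r (log 2 n)" using elim unfolding d_def by linarith+
    have D: "log 2 n / 8 \<le> real (D n)" "real (D n) \<le> log 2 n / 4" using elim unfolding D_def by linarith+
    have "real (d n) \<le> real (D n)" using d D elim by linarith
    thus ?case using d D elim by simp
  qed
  have "asymp_almost_surely (\<lambda>n. random_kneser_graph n 2 (1/2))
       (\<lambda>n G. real (chromatic_number G) \<le> real n - real (d n))"
  proof (rule asymp_almost_surely_chromatic_number_le[where D = D and s = s])
    show "\<forall>\<^sub>F n in sequentially. d n \<le> D n" using ev by eventually_elim blast
    show "\<forall>\<^sub>F n in sequentially. real (D n) \<le> log 2 n" using ev by eventually_elim linarith
    show "\<forall>\<^sub>F n in sequentially. \<forall>i. d n \<le> i \<and> i < D n \<longrightarrow> real (s n i * i ^ (2 - 1)) \<le> log 2 n / 2"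
      using ev
    proof (eventually_elim, intro allI impI)
      fix n i assume *: "1 \<le> d n \<and> d n \<le> D n \<and> real (d n) \<le> 2 * r (log 2 n)
      \<and> log 2 n / 8 \<le> real (D n) \<and> real (D n) \<le> log 2 n / 4 \<and> 8 \<le> log 2 n
      \<and> (2 * r (log 2 n)) ^ 2 + log 2 n / 2 \<le> log 2 n / 4 * ln (log 2 n / 8 / (2 * r (log 2 n)))"
        and i: "d n \<le> i \<and> i < D n"
      have "real (s n i) * real i \<le> log 2 n / (2 * real i) * real i"
        unfolding s_def using * i by (intro mult_right_mono) auto
      thus "real (s n i * i ^ (2 - 1)) \<le> log 2 n / 2" using * i by simp
    qed
    show "\<forall>\<^sub>F n in sequentially. \<forall>i\<ge>d n. s n i \<le> s n (d n)"
      using ev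
    proof eventually_elim
      case (elim n)
      show ?case unfolding s_def using elim by (intro allI impI nat_mono floor_mono divide_left_mono) auto
    qed
    show "\<forall>\<^sub>F n in sequentially. d n ^ 2 + s n (d n) * d n \<le> (\<Sum>i\<in>{d n..<D n}. s n i)"
      using ev
    proof eventually_elim
      case (elim n)
      let ?L = "log 2 (real n)"
      have "real (s n (d n)) * real (d n) \<le> ?L / (2 * real (d n)) * real (d n)"
        unfolding s_def using elim by (intro mult_right_mono) auto
      also have "\<dots> = ?L / 2" using elim by simp
      finally have "real (d n ^ 2 + s n (d n) * d n) \<le> (2 * r ?L) ^ 2 + ?L / 2"
        using elim power_mono[of "real (d n)" "2 * r ?L" 2] by simp
      also have "\<dots> \<le> ?L / 4 * ln (?L / 8 / (2 * r ?L))" using elim by blast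
      also have "\<dots> \<le> ?L / 4 * ln (real (D n) / real (d n))"
      proof (intro mult_left_mono ln_mono frac_le)
        have "0 < 2 * r ?L" using elim by linarith
        thus "0 < ?L / 8 / (2 * r ?L)" using elim by simp
      qed (use elim in auto)
      also have "\<dots> \<le> ?L / 4 * (\<Sum>i\<in>{d n..<D n}. 1 / real i)"
        using elim by (intro mult_left_mono ln_ratio_le_sum_inverse) auto
      also have "\<dots> = (\<Sum>i\<in>{d n..<D n}. ?L / (4 * real i))" by (simp add: sum_distrib_left)
      also have "\<dots> \<le> (\<Sum>i\<in>{d n..<D n}. real (s n i))"
      proof (intro sum_mono)
        fix i assume i: "i \<in> {d n..<D n}"
        hence "real i \<le> ?L / 4" "i \<ge> 1" using elim by auto
        \<comment> \<open>For \<open>i \<le> L / 4\<close>, rounding down loses at most half of \<open>L / (2 * i)\<close>.\<close>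
        hence "1 \<le> ?L / (4 * real i)" by (simp add: field_simps)
        moreover have "?L / (2 * real i) = ?L / (4 * real i) + ?L / (4 * real i)" by (simp add: field_simps)
        ultimately show "?L / (4 * real i) \<le> real (s n i)" unfolding s_def by linarith
      qed
      finally show ?case by (simp only: of_nat_le_iff flip: of_nat_sum)
    qed
  qed simp
  moreover have "r (log 2 n) \<le> real (d n)" for n unfolding d_def by linarith
  hence "real n - real (d n) \<le> real n - 1 / 16 * sqrt (log 2 n * log 2 (log 2 n))" for n
    by (simp add: r_def)
  ultimately show ?thesis
    by (elim asymp_almost_surely_mono) (intro always_eventually allI ballI impI, erule order_trans)
qed

theorem theorem1:
  shows "(\<forall>k::nat. k \<ge> 3 \<longrightarrow>
           (\<exists>c1 c2 :: real. c1 > 0 \<and> c2 > 0 \<and>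
             asymp_almost_surely (\<lambda>n. random_kneser_graph n k (1/2))
               (\<lambda>n G.
                 real n - c2 * log 2 (real n) powr (1 / (2 * real k - 2))
                   \<le> real (chromatic_number G) \<and>
                 real (chromatic_number G)
                   \<le> real n - c1 * log 2 (real n) powr (1 / (2 * real k - 2)))))
       \<and> (\<exists>c1 c2 :: real. c1 > 0 \<and> c2 > 0 \<and>
            asymp_almost_surely (\<lambda>n. random_kneser_graph n 2 (1/2))
              (\<lambda>n G.
                real n - c2 * sqrt (log 2 (real n) * log 2 (log 2 (real n)))
                  \<le> real (chromatic_number G) \<and>
                real (chromatic_number G)
                  \<le> real n - c1 * sqrt (log 2 (real n) * log 2 (log 2 (real n)))))"
proof (intro conjI allI impI)
  fix k :: nat assume k: "k \<ge> 3"
  obtain c2 :: real where c2: "c2 > 0"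
    "asymp_almost_surely (\<lambda>n. random_kneser_graph n k (1/2))
       (\<lambda>n G. real n - c2 * log 2 n powr (1 / (2 * real k - 2)) \<le> real (chromatic_number G))"
    using kneser_lower_ge3[OF k] by blast
  show "\<exists>c1 c2 :: real. c1 > 0 \<and> c2 > 0 \<and>
             asymp_almost_surely (\<lambda>n. random_kneser_graph n k (1/2))
               (\<lambda>n G.
                 real n - c2 * log 2 (real n) powr (1 / (2 * real k - 2))
                   \<le> real (chromatic_number G) \<and>
                 real (chromatic_number G)
                   \<le> real n - c1 * log 2 (real n) powr (1 / (2 * real k - 2)))"
    using asymp_almost_surely_conj[OF c2(2) kneser_upper_ge3[OF k]] c2(1)
    by (intro exI[of _ "1/12"] exI[of _ c2]) simp
next
  obtain c2 :: real where c2: "c2 > 0"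
    "asymp_almost_surely (\<lambda>n. random_kneser_graph n 2 (1/2))
       (\<lambda>n G. real n - c2 * sqrt (log 2 n * log 2 (log 2 n)) \<le> real (chromatic_number G))"
    using kneser_lower_2 by blast
  show "\<exists>c1 c2 :: real. c1 > 0 \<and> c2 > 0 \<and>
            asymp_almost_surely (\<lambda>n. random_kneser_graph n 2 (1/2))
              (\<lambda>n G.
                real n - c2 * sqrt (log 2 (real n) * log 2 (log 2 (real n)))
                  \<le> real (chromatic_number G) \<and>
                real (chromatic_number G)
                  \<le> real n - c1 * sqrt (log 2 (real n) * log 2 (log 2 (real n))))"
    using asymp_almost_surely_conj[OF c2(2) kneser_upper_2] c2(1)
    by (intro exI[of _ "1/16"] exI[of _ c2]) simp
qed

end
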